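(* Let $k\ge2$ and $d\ge1$ be integers. Then the polynomial $J^{d,n}_{p_k}(X)=\sum_{j=0}^d\binom djp_k(n+j)X^j$ is hyperbolic for all sufficiently large $n$.
   Context: $p_k(n)$ is the number of $k$-regular partitions of $n$, i.e. partitions of $n$ with no part divisible by $k$. A polynomial with real coefficients is hyperbolic if all of its roots are real. *)

theory Defs
  imports
    Complex_Main
    "HOL-Library.Multiset"
    "HOL-Computational_Algebra.Polynomial"
begin

definition partitions_of :: "nat \<Rightarrow> nat multiset set" where
  "partitions_of n = {M. (\<forall>m\<in>#M. 0 < m) \<and> sum_mset M = n}"

definition regular_partitions :: "nat \<Rightarrow> nat \<Rightarrow> nat multiset set" where
  "regular_partitions k n = {M \<in> partitions_of n. \<forall>m\<in>#M. \<not> k dvd m}"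

definition num_regular_partitions :: "nat \<Rightarrow> nat \<Rightarrow> nat" where
  "num_regular_partitions k n = card (regular_partitions k n)"

(* The sets counted by card are finite, so card does not take its default value 0. *)
lemma finite_partitions_of: "finite (partitions_of n)"
proof -
  have size_le: "size M \<le> sum_mset M" if "\<forall>m\<in>#M. 0 < m" for M :: "nat multiset"
    using that by (induction M) auto
  have elem_le: "m \<le> sum_mset M" if "m \<in># M" for m and M :: "nat multiset"
    using that by (induction M) auto
  have "partitions_of n \<subseteq> mset ` {xs. set xs \<subseteq> {..n} \<and> length xs \<le> n}"
  proof
    fix M assume M: "M \<in> partitions_of n"
    obtain xs where xs: "mset xs = M"
      using ex_mset by blast
    have "set xs \<subseteq> {..n}"
      using M elem_le xs unfolding partitions_of_def by fastforce
    moreover have "length xs \<le> n"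
      using M size_le[of M] xs unfolding partitions_of_def by auto
    ultimately show "M \<in> mset ` {xs. set xs \<subseteq> {..n} \<and> length xs \<le> n}"
      using xs by blast
  qed
  then show ?thesis
    using finite_lists_length_le[of "{..n}" n] finite_subset by blast
qed

lemma finite_regular_partitions: "finite (regular_partitions k n)"
  unfolding regular_partitions_def using finite_partitions_of by simp

definition jensen_poly :: "(nat \<Rightarrow> real) \<Rightarrow> nat \<Rightarrow> nat \<Rightarrow> real poly" where
  "jensen_poly \<alpha> d n = (\<Sum>j=0..d. monom (real (d choose j) * \<alpha> (n + j)) j)"

(* The roots are the complex ones; in particular the zero polynomial is not hyperbolic. *)
definition hyperbolic :: "real poly \<Rightarrow> bool" where
  "hyperbolic p \<longleftrightarrow> (\<forall>z::complex. poly (map_poly complex_of_real p) z = 0 \<longrightarrow> z \<in> \<real>)"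

end

theory Submission
  imports Defs "HOL-Probability.Probability" "HOL-Complex_Analysis.Complex_Analysis"
begin

text \<open>
  Let $A(q) = \sum_m p_k(m) q^m$. Cauchy's formula applied to the whole Jensen polynomial gives
  \<open>2\<pi> r^n J(X) = \<integral> A(r e^{iy}) e^{-iny} (1 + (X/r) e^{-iy})^d dy\<close>. Choose $r = e^{-\eta}$ as the
  saddle point, so that the random integer with weights $p_k(m) r^m / A(r)$ has mean $n$, and put
  $X = -r(1 - \sigma x)$, $y = \sigma t$ with $\sigma^{-2}$ its variance. By dominated convergence the
  integral, divided by $\sigma^{d+1} A(r)$, tends to
  \<open>\<integral> e^{-t^2/2} (x + it)^d dt = \<surd>(2\<pi>) H_d(x)\<close>, where $H_d$ is the Hermite polynomial. Hence for
  large $n$ the Jensen polynomial alternates in sign at $d + 1$ points, as $H_d$ does, and all its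
  $d$ roots are real. Only the central limit theorem for this random integer and a crude bound on
  its characteristic function are needed, no asymptotic expansion of $p_k$.
\<close>

section \<open>Combinatorics of regular partitions\<close>

text \<open>The coefficients of J cannot be estimated one by one: the values p_k(n + j) agree to
  leading order, so the binomial sum cancels almost completely near X = -r, and each of them would
  be needed to relative accuracy \<sigma>^d. Under the integral the cancellation is explicit,
  because the bracket raised to the power d is itself of order \<sigma> for bounded t. The remaining
  obstacle is a majorant on the whole range |t| \<le> \<pi>/\<sigma>, including y near the k-th
  roots of unity. Lower bounds for sums of |1 - w^m|^2 over m not divisible by k bound the
  characteristic function by exp(-c min(1/\<eta>, t^2)). The variance lies between constant
  multiples of \<eta>^(-3), hence t^2 = O(\<eta>^(-3)) on this range, and exp(-c/\<eta>) still beats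
  every power of t. The third cumulant is O(\<eta>^(-4)), which makes the skewness O(\<eta>^(1/2));
  these orders of magnitude suffice for the normal limit.\<close>

definition divisor_sum :: "nat \<Rightarrow> nat \<Rightarrow> nat" where
  "divisor_sum k N = (\<Sum>m | m dvd N \<and> \<not> k dvd m. m)"

lemma regular_partitionsD:
  assumes "M \<in> regular_partitions k n" "m \<in># M"
  shows "0 < m" "\<not> k dvd m"
  using assms by (auto simp: regular_partitions_def partitions_of_def)

text \<open>Removing j copies of m is a bijection onto the regular partitions of n - m j; putting
  them back preserves regularity because k does not divide m.\<close>

lemma card_regular_partitions_count_ge:
  assumes "0 < m"  "0 < j" "\<not> k dvd m" "m * j \<le> n"
  shows "card {M \<in> regular_partitions k n. j \<le> count M m} = num_regular_partitions k (n - m * j)"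
proof -
  have "bij_betw (\<lambda>M. M + replicate_mset j m) (regular_partitions k (n - m * j))
          {M \<in> regular_partitions k n. j \<le> count M m}"
  proof (rule bij_betw_byWitness[where f' = "\<lambda>M. M - replicate_mset j m"])
    have sub: "replicate_mset j m \<subseteq># M" if "j \<le> count M m" for M
      using that by (simp add: count_le_replicate_mset_subset_eq)
    show "\<forall>M\<in>regular_partitions k (n - m * j). M + replicate_mset j m - replicate_mset j m = M"
      by simp
    show "\<forall>M\<in>{M \<in> regular_partitions k n. j \<le> count M m}. M - replicate_mset j m + replicate_mset j m = M"
      using sub by (simp add: subset_mset.diff_add)
    show "(\<lambda>M. M + replicate_mset j m) ` regular_partitions k (n - m * j)
        \<subseteq> {M \<in> regular_partitions k n. j \<le> count M m}"
      using assms by (auto simp: regular_partitions_def partitions_of_def mult.commute split: if_splits)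
    show "(\<lambda>M. M - replicate_mset j m) ` {M \<in> regular_partitions k n. j \<le> count M m}
        \<subseteq> regular_partitions k (n - m * j)"
    proof clarify
      fix M assume M: "M \<in> regular_partitions k n" "j \<le> count M m"
      define M' where "M' = M - replicate_mset j m"
      have "M = M' + replicate_mset j m"
        using sub[OF M(2)] by (simp add: M'_def subset_mset.diff_add)
      then show "M - replicate_mset j m \<in> regular_partitions k (n - m * j)"
        using M(1) unfolding M'_def[symmetric]
        by (auto simp: regular_partitions_def partitions_of_def mult.commute)
    qed
  qed
  then show ?thesis
    by (simp add: num_regular_partitions_def bij_betw_same_card)
qed

lemma sum_mset_count:
  fixes M :: "nat multiset"
  assumes "finite A" "set_mset M \<subseteq> A"
  shows "sum_mset M = (\<Sum>m\<in>A. m * count M m)"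
  using assms(2)
proof (induction M)
  case (add x M)
  have "(\<Sum>m\<in>A. m * count (add_mset x M) m) = (\<Sum>m\<in>A. m * count M m + (if m = x then x else 0))"
    by (intro sum.cong) auto
  then show ?case
    using add assms(1) by (simp add: sum.distrib)
qed simp

lemma factor_pairs_subset:
  "{(m, j). 0 < j \<and> \<not> k dvd m \<and> m * j \<le> n \<and> 0 < (m :: nat)} \<subseteq> {1..n} \<times> {1..n}"
proof (rule subrelI)
  fix m j :: nat
  assume "(m, j) \<in> {(m, j). 0 < j \<and> \<not> k dvd m \<and> m * j \<le> n \<and> 0 < m}"
  then have mj: "m * j \<le> n" "0 < m" "0 < j" by auto
  then have "m \<le> m * j" "j \<le> m * j" by simp_all
  from this[THEN order_trans, OF mj(1)] mj show "(m, j) \<in> {1..n} \<times> {1..n}" by simp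
qed

lemma finite_factor_pairs:
  "finite {(m, j). 0 < j \<and> \<not> k dvd m \<and> m * j \<le> n \<and> 0 < (m :: nat)}"
  by (rule finite_subset[OF factor_pairs_subset]) simp

text \<open>A part m of multiplicity c is counted once for each level j = 1, ..., c. The index set
  of pairs (m, j) does not depend on M, so that the sum can later be interchanged with the sum over
  all partitions.\<close>

lemma sum_mset_regular_partition:
  assumes M: "M \<in> regular_partitions k n"
  shows "n = (\<Sum>(m, j) \<in> {(m, j). 0 < j \<and> \<not> k dvd m \<and> m * j \<le> n \<and> 0 < m}.
               m * (if j \<le> count M m then 1 else 0))"
proof -
  have size: "m * count M m \<le> n" for m
  proof -
    have "replicate_mset (count M m) m \<subseteq># M"
      by (simp flip: count_le_replicate_mset_subset_eq)
    then have "sum_mset (replicate_mset (count M m) m) \<le> sum_mset M"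
      by (metis le_add1 subset_mset.le_iff_add sum_mset.union)
    then show ?thesis
      using M by (simp add: regular_partitions_def partitions_of_def mult.commute)
  qed
  have "n = (\<Sum>m\<in>set_mset M. m * count M m)"
    using M by (simp add: regular_partitions_def partitions_of_def sum_mset_count[of "set_mset M"])
  also have "\<dots> = (\<Sum>m\<in>set_mset M. \<Sum>j\<in>{1..count M m}. m)"
    by (simp add: mult.commute)
  also have "\<dots> = (\<Sum>(m, j) \<in> Sigma (set_mset M) (\<lambda>m. {1..count M m}). m)"
    by (subst sum.Sigma) auto
  also have "\<dots> = (\<Sum>(m, j) \<in> {(m, j). 0 < j \<and> \<not> k dvd m \<and> m * j \<le> n \<and> 0 < m}.
               m * (if j \<le> count M m then 1 else 0))"
  proof (rule sum.mono_neutral_cong_left[OF finite_factor_pairs])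
    show "Sigma (set_mset M) (\<lambda>m. {1..count M m}) \<subseteq> {(m, j). 0 < j \<and> \<not> k dvd m \<and> m * j \<le> n \<and> 0 < m}"
      using regular_partitionsD[OF M] size by (auto intro: order_trans[OF mult_le_mono2])
    show "\<forall>i\<in>{(m, j). 0 < j \<and> \<not> k dvd m \<and> m * j \<le> n \<and> 0 < m} - Sigma (set_mset M) (\<lambda>m. {1..count M m}).
       (case i of (m, j) \<Rightarrow> m * (if j \<le> count M m then 1 else 0)) = 0"
      by (auto simp: Suc_le_eq simp flip: count_greater_zero_iff split: if_splits)
  qed auto
  finally show ?thesis .
qed

lemma sum_divisors_eq:
  fixes f :: "nat \<Rightarrow> nat \<Rightarrow> 'a::comm_monoid_add"
  shows "(\<Sum>N=1..n. \<Sum>m | m dvd N \<and> \<not> k dvd m. f N m)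
    = (\<Sum>(m, j) \<in> {(m, j). 0 < j \<and> \<not> k dvd m \<and> m * j \<le> n \<and> 0 < m}. f (m * j) m)"
proof -
  have "(\<Sum>N=1..n. \<Sum>m | m dvd N \<and> \<not> k dvd m. f N m)
      = (\<Sum>(N, m)\<in>Sigma {1..n} (\<lambda>N. {m. m dvd N \<and> \<not> k dvd m}). f N m)"
    by (subst sum.Sigma) auto
  also have "\<dots> = (\<Sum>(m, j) \<in> {(m, j). 0 < j \<and> \<not> k dvd m \<and> m * j \<le> n \<and> 0 < m}. f (m * j) m)"
  proof (rule sum.reindex_bij_witness[where j = "\<lambda>(N, m). (m, N div m)" and i = "\<lambda>(m, j). (m * j, m)"], goal_cases)
    case (2 b)
    then obtain N m where b: "b = (N, m)" "1 \<le> N" "N \<le> n" "m dvd N" "\<not> k dvd m" by auto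
    then have "0 < m" by (intro Nat.gr0I) auto
    with b show ?case by (auto simp: Suc_le_eq div_greater_zero_iff dvd_imp_le)
  qed auto
  finally show ?thesis .
qed

text \<open>Double counting of the total size of all regular partitions of n: a pair (m, j)
  contributes m for each partition that contains m at least j times, and the pairs are then grouped
  by N = m j.\<close>

lemma num_regular_partitions_recurrence:
  "n * num_regular_partitions k n
     = (\<Sum>N=1..n. divisor_sum k N * num_regular_partitions k (n - N))"
proof -
  define P where "P = {(m, j). 0 < j \<and> \<not> k dvd m \<and> m * j \<le> n \<and> 0 < m}"
  have "n * num_regular_partitions k n = (\<Sum>M\<in>regular_partitions k n. n)"
    by (simp add: num_regular_partitions_def mult.commute)
  also have "\<dots> = (\<Sum>M\<in>regular_partitions k n. \<Sum>(m, j)\<in>P. m * (if j \<le> count M m then 1 else 0))"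
    unfolding P_def by (intro sum.cong refl sum_mset_regular_partition)
  also have "\<dots> = (\<Sum>(m, j)\<in>P. m * (\<Sum>M\<in>regular_partitions k n. if j \<le> count M m then 1 else 0))"
    by (subst sum.swap) (simp add: sum_distrib_left case_prod_unfold)
  also have "\<dots> = (\<Sum>(m, j)\<in>P. m * card {M \<in> regular_partitions k n. j \<le> count M m})"
    by (simp add: finite_regular_partitions flip: sum.inter_filter)
  also have "\<dots> = (\<Sum>(m, j)\<in>P. m * num_regular_partitions k (n - m * j))"
    by (intro sum.cong refl) (auto simp: P_def card_regular_partitions_count_ge)
  also have "\<dots> = (\<Sum>N=1..n. \<Sum>m | m dvd N \<and> \<not> k dvd m. m * num_regular_partitions k (n - N))"
    unfolding P_def by (rule sum_divisors_eq[symmetric])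
  also have "\<dots> = (\<Sum>N=1..n. divisor_sum k N * num_regular_partitions k (n - N))"
    by (simp add: divisor_sum_def sum_distrib_right)
  finally show ?thesis .
qed

lemma num_regular_partitions_0: "num_regular_partitions k 0 = 1"
proof -
  have "regular_partitions k 0 = {{#}}"
    by (auto simp: regular_partitions_def partitions_of_def) (metis less_irrefl multiset_nonemptyE)
  then show ?thesis by (simp add: num_regular_partitions_def)
qed

section \<open>Hermite polynomials and alternation\<close>

text \<open>These are the values at 0 of the probabilists' Hermite polynomials, equivalently the
  moments of i T for a standard normal T. Thus \<open>hermite d x\<close> is the expectation of (x +
  i T)^d, expanded by the binomial theorem.\<close>

fun hermite_const :: "nat \<Rightarrow> real" where
  "hermite_const 0 = 1"
| "hermite_const (Suc 0) = 0"
| "hermite_const (Suc (Suc j)) = - (real j + 1) * hermite_const j"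

definition hermite :: "nat \<Rightarrow> real \<Rightarrow> real" where
  "hermite d x = (\<Sum>j\<le>d. real (d choose j) * hermite_const j * x ^ (d - j))"

lemma hermite_0 [simp]: "hermite 0 x = 1"
  and hermite_1 [simp]: "hermite (Suc 0) x = x"
  by (simp_all add: hermite_def)

text \<open>Pascal's rule splits the sum: one half is x H_(d+1), and in the other the absorption
  identity (j + 1) C(d+1, j+1) = (d + 1) C(d, j) meets the recurrence of
  \<open>hermite_const\<close>.\<close>

lemma hermite_Suc_Suc:
  "hermite (Suc (Suc d)) x = x * hermite (Suc d) x - (real d + 1) * hermite d x"
proof -
  let ?c = hermite_const
  have "hermite (Suc (Suc d)) x = x ^ (d + 2)
      + (\<Sum>j\<le>Suc d. real (Suc (Suc d) choose Suc j) * ?c (Suc j) * x ^ (Suc d - j))"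
    unfolding hermite_def by (subst sum.atMost_Suc_shift) simp
  also have "(\<Sum>j\<le>Suc d. real (Suc (Suc d) choose Suc j) * ?c (Suc j) * x ^ (Suc d - j))
     = (\<Sum>j\<le>Suc d. real (Suc d choose Suc j) * ?c (Suc j) * x ^ (Suc d - j))
     + (\<Sum>j\<le>Suc d. real (Suc d choose j) * ?c (Suc j) * x ^ (Suc d - j))"
    by (simp add: sum.distrib[symmetric] algebra_simps del: sum.atMost_Suc)
  also have "x ^ (d + 2) + \<dots> = x * hermite (Suc d) x
     + (\<Sum>j\<le>Suc d. real (Suc d choose j) * ?c (Suc j) * x ^ (Suc d - j))"
  proof -
    have "x * hermite (Suc d) x = x * (x ^ Suc d + (\<Sum>j\<le>d. real (Suc d choose Suc j) * ?c (Suc j) * x ^ (d - j)))"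
      unfolding hermite_def by (subst sum.atMost_Suc_shift) simp
    also have "\<dots> = x ^ (d + 2) + (\<Sum>j\<le>d. real (Suc d choose Suc j) * ?c (Suc j) * x ^ (Suc d - j))"
      by (simp add: algebra_simps sum_distrib_left Suc_diff_le)
    finally show ?thesis by (simp add: binomial_eq_0 del: binomial_Suc_Suc)
  qed
  \<comment> \<open>The term j = 0 drops out because
    \<open>hermite_const (Suc 0) = 0\<close>.\<close>
  also have "(\<Sum>j\<le>Suc d. real (Suc d choose j) * ?c (Suc j) * x ^ (Suc d - j))
     = (\<Sum>j\<le>d. real (Suc d choose Suc j) * ?c (Suc (Suc j)) * x ^ (d - j))"
    by (subst sum.atMost_Suc_shift) simp
  also have "\<dots> = (\<Sum>j\<le>d. - (real d + 1) * (real (d choose j) * ?c j * x ^ (d - j)))"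
  proof (rule sum.cong[OF refl])
    fix j
    have "real (Suc d choose Suc j) * (real j + 1) = (real d + 1) * real (d choose j)"
      using Suc_times_binomial[of j d] by (metis mult.commute of_nat_Suc of_nat_mult add.commute)
    then have "- (real (Suc d choose Suc j) * (real j + 1)) * (?c j * x ^ (d - j))
        = - ((real d + 1) * real (d choose j)) * (?c j * x ^ (d - j))"
      by (simp only:)
    then show "real (Suc d choose Suc j) * ?c (Suc (Suc j)) * x ^ (d - j)
        = - (real d + 1) * (real (d choose j) * ?c j * x ^ (d - j))"
      by (simp only: hermite_const.simps mult_minus_left mult_minus_right mult_ac)
  qed
  also have "\<dots> = - (real d + 1) * hermite d x"
    by (simp add: hermite_def sum_distrib_left)
  finally show ?thesis by (simp add: algebra_simps)
qed

lemma hermite_minus: "hermite d (- x) = (- 1) ^ d * hermite d x"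
  by (induction d rule: induct_nat_012) (simp_all add: hermite_Suc_Suc algebra_simps)

lemma hermite_deriv:
  "(hermite (Suc d) has_real_derivative (real d + 1) * hermite d x) (at x)"
proof (induction d rule: induct_nat_012)
  case 0
  have "hermite (Suc 0) = (\<lambda>x. x)" by auto
  then show ?case by simp
next
  case 1
  have "hermite (Suc (Suc 0)) = (\<lambda>x. x * x - 1)" by (auto simp: hermite_Suc_Suc)
  then show ?case by (auto intro!: derivative_eq_intros)
next
  case (ge2 d)
  have "hermite (Suc (Suc (Suc d))) = (\<lambda>x. x * hermite (Suc (Suc d)) x - (real (Suc d) + 1) * hermite (Suc d) x)"
    by (rule ext) (rule hermite_Suc_Suc)
  then show ?case
    using DERIV_diff[OF DERIV_mult[OF DERIV_ident ge2(2)] DERIV_cmult[OF ge2(1), of "real (Suc d) + 1"]]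
    by (simp add: hermite_Suc_Suc[of d] algebra_simps)
qed

lemma hermite_has_deriv:
  "(hermite d has_real_derivative x * hermite d x - hermite (Suc d) x) (at x)"
proof (cases d)
  case 0
  have "hermite 0 = (\<lambda>_. 1)" by auto
  then show ?thesis using 0 by simp
next
  case (Suc e)
  then show ?thesis using hermite_deriv[of e x] by (simp add: hermite_Suc_Suc)
qed

lemma hermite_weighted_deriv:
  "((\<lambda>x. exp (- x\<^sup>2 / 2) * hermite d x) has_real_derivative - exp (- x\<^sup>2 / 2) * hermite (Suc d) x) (at x)"
  by (auto intro!: derivative_eq_intros hermite_has_deriv simp: algebra_simps)

text \<open>The polynomial is monic: after division by x^d it becomes a polynomial in 1/x with
  constant term \<open>hermite_const 0 = 1\<close>.\<close>

lemma hermite_eventually_pos: "\<forall>\<^sub>F x in at_top. hermite d x > 0"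
proof -
  have "((\<lambda>x. \<Sum>j\<le>d. real (d choose j) * hermite_const j * inverse x ^ j) \<longlongrightarrow>
          (\<Sum>j\<le>d. real (d choose j) * hermite_const j * 0 ^ j)) at_top"
    by (intro tendsto_intros tendsto_inverse_0_at_top filterlim_ident)
  also have "(\<Sum>j\<le>d. real (d choose j) * hermite_const j * 0 ^ j) = 1"
    by (simp add: sum.atMost_shift power_0_left)
  finally have "\<forall>\<^sub>F x in at_top. (\<Sum>j\<le>d. real (d choose j) * hermite_const j * inverse x ^ j) > 0"
    by (rule order_tendstoD) simp
  then show ?thesis
    using eventually_gt_at_top[of 0]
  proof eventually_elim
    case (elim x)
    have "hermite d x = x ^ d * (\<Sum>j\<le>d. real (d choose j) * hermite_const j * inverse x ^ j)"
      unfolding hermite_def sum_distrib_left using elim(2)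
      by (intro sum.cong refl) (simp add: power_diff field_simps)
    then show ?case using elim by simp
  qed
qed

text \<open>
  As $(e^{-x^2/2} H_d)' = - e^{-x^2/2} H_{d+1}$, the mean value theorem produces a point of prescribed
  sign of $H_{d+1}$ between any two consecutive alternation points of $H_d$; the two outermost points
  come from the behaviour at infinity.
\<close>

lemma hermite_alternates:
  "\<exists>x. (\<forall>i<d. x i < x (Suc i)) \<and> (\<forall>i\<le>d. (- 1) ^ (d + i) * hermite d (x i) > 0)"
proof (induction d)
  case 0
  then show ?case by (intro exI[of _ "\<lambda>_. 0"]) simp
next
  case (Suc d)
  then obtain x where mono: "\<And>i. i < d \<Longrightarrow> x i < x (Suc i)"
    and pos: "\<And>i. i \<le> d \<Longrightarrow> (- 1) ^ (d + i) * hermite d (x i) > 0" by blast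
  let ?g = "\<lambda>t. exp (- t\<^sup>2 / 2) * hermite d t"
  have "\<exists>c. x i < c \<and> c < x (Suc i) \<and> (- 1) ^ (d + i) * hermite (Suc d) c > 0" if i: "i < d" for i
  proof -
    obtain c where c: "x i < c" "c < x (Suc i)"
      and eq: "?g (x (Suc i)) - ?g (x i) = (x (Suc i) - x i) * (- exp (- c\<^sup>2 / 2) * hermite (Suc d) c)"
      using MVT2[OF mono[OF i] hermite_weighted_deriv] by blast
    \<comment> \<open>The values of \<open>?g\<close> at the two endpoints have opposite signs; the
      minus sign in the derivative of \<open>?g\<close> then turns this into positivity for
      H_(d+1).\<close>
    have "(- 1) ^ (d + i) * (?g (x (Suc i)) - ?g (x i)) < 0"
      using mult_pos_pos[OF exp_gt_zero pos[of i], of "- (x i)\<^sup>2 / 2"]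
        mult_pos_pos[OF exp_gt_zero pos[of "Suc i"], of "- (x (Suc i))\<^sup>2 / 2"] i
      by (simp add: algebra_simps)
    then have "((x (Suc i) - x i) * exp (- c\<^sup>2 / 2)) * ((- 1) ^ (d + i) * hermite (Suc d) c) > 0"
      unfolding eq by (simp add: algebra_simps)
    then have "(- 1) ^ (d + i) * hermite (Suc d) c > 0"
      by (rule zero_less_mult_pos) (use mono[OF i] in simp)
    with c show ?thesis by blast
  qed
  then have "\<forall>i\<in>{..<d}. \<exists>c. x i < c \<and> c < x (Suc i) \<and> (- 1) ^ (d + i) * hermite (Suc d) c > 0"
    by blast
  from bchoice[OF this] obtain c where c: "\<And>i. i < d \<Longrightarrow> x i < c i" "\<And>i. i < d \<Longrightarrow> c i < x (Suc i)"
    "\<And>i. i < d \<Longrightarrow> (- 1) ^ (d + i) * hermite (Suc d) (c i) > 0"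
    by blast
  obtain R where R: "\<And>t. t \<ge> R \<Longrightarrow> hermite (Suc d) t > 0"
    using hermite_eventually_pos[of "Suc d"] by (auto simp: eventually_at_top_linorder)
  define a where "a = Min (insert (- R) (x ` {..d})) - 1"
  define b where "b = Max (insert R (x ` {..d})) + 1"
  have "Min (insert (- R) (x ` {..d})) \<le> - R" "\<And>i. i \<le> d \<Longrightarrow> Min (insert (- R) (x ` {..d})) \<le> x i"
    by (rule Min_le; simp)+
  then have a: "a \<le> - R" "\<And>i. i \<le> d \<Longrightarrow> a < x i"
    unfolding a_def by (smt (verit))+
  have "R \<le> Max (insert R (x ` {..d}))" "\<And>i. i \<le> d \<Longrightarrow> x i \<le> Max (insert R (x ` {..d}))"
    by (rule Max_ge; simp)+
  then have b: "b \<ge> R" "\<And>i. i \<le> d \<Longrightarrow> x i < b"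
    unfolding b_def by (smt (verit))+
  \<comment> \<open>The point \<open>c i\<close> receives index i + 1, so that (d + 1) + (i + 1) has
    the parity d + i with which its sign was established.\<close>
  define y where "y i = (if i = 0 then a else if i \<le> d then c (i - 1) else b)" for i
  have "y i < y (Suc i)" if "i < Suc d" for i
  proof (cases i)
    case 0
    then show ?thesis
      using a(2)[of 0] b(2)[of 0] c(1)[of 0] that by (auto simp: y_def)
  next
    case (Suc j)
    then show ?thesis
      using c(1)[of "Suc j"] c(2)[of j] b(2)[of "Suc j"] that
      by (cases "i = d") (auto simp: y_def)
  qed
  moreover have "(- 1) ^ (Suc d + i) * hermite (Suc d) (y i) > 0" if "i \<le> Suc d" for i
  proof -
    have "(- 1) ^ Suc d * hermite (Suc d) a > 0"
      using R[of "- a"] a(1) by (simp add: hermite_minus del: power_Suc)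
    moreover have "hermite (Suc d) b > 0"
      using R b(1) by simp
    ultimately show ?thesis
      using c(3)[of "i - 1"] that by (cases i) (auto simp: y_def not_le le_Suc_eq simp flip: mult_2 power_add)
  qed
  ultimately show ?case by blast
qed

text \<open>The d sign changes give d real zeros in disjoint intervals. A nonreal zero would be one
  more, exceeding the degree bound; p is not zero since its value at \<open>x 0\<close> is
  not.\<close>

lemma hyperbolic_if_alternates:
  fixes p :: "real poly"
  assumes deg: "degree p \<le> d"
    and mono: "\<And>i. i < d \<Longrightarrow> x i < x (Suc i)"
    and pos: "\<And>i. i \<le> d \<Longrightarrow> (- 1) ^ (d + i) * poly p (x i) > 0"
  shows "hyperbolic p"
proof -
  have "\<exists>r. x i < r \<and> r < x (Suc i) \<and> poly p r = 0" if i: "i < d" for i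
  proof (rule poly_IVT[OF mono[OF i]])
    have "((- 1) ^ (d + i) * poly p (x i)) * ((- 1) ^ (d + Suc i) * poly p (x (Suc i))) > 0"
      by (intro mult_pos_pos pos) (use i in auto)
    moreover have "((- 1) ^ (d + i) * poly p (x i)) * ((- 1) ^ (d + Suc i) * poly p (x (Suc i)))
        = (-1) ^ (2 * (d + i)) * (- (poly p (x i) * poly p (x (Suc i))))"
      by (simp only: power_mult[symmetric] mult_2 power_add add_Suc_right power_Suc) algebra
    ultimately show "poly p (x i) * poly p (x (Suc i)) < 0"
      by (simp only: power_mult) simp
  qed
  then obtain r where r: "\<And>i. i < d \<Longrightarrow> x i < r i" "\<And>i. i < d \<Longrightarrow> r i < x (Suc i)"
    "\<And>i. i < d \<Longrightarrow> poly p (r i) = 0" by metis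
  have xle: "x i \<le> x j" if "i \<le> j" "j \<le> d" for i j
    using that
  proof (induction j rule: dec_induct)
    case (step m)
    then show ?case using mono[of m] by force
  qed simp
  have "r i < r j" if "i < j" "j < d" for i j
    using r(2)[of i] r(1)[of j] xle[of "Suc i" j] that by linarith
  then have inj: "inj_on r {..<d}"
    by (intro linorder_inj_onI) (auto, metis less_irrefl)
  let ?P = "map_poly complex_of_real p"
  have "p \<noteq> 0" using pos[of 0] by auto
  then have P: "?P \<noteq> 0" by (simp add: map_poly_eq_0_iff)
  have ev: "poly ?P (of_real t) = of_real (poly p t)" for t
    by (induction p) (simp_all add: map_poly_pCons)
  show ?thesis
    unfolding hyperbolic_def
  proof (intro allI impI)
    fix z assume z: "poly ?P z = 0"
    show "z \<in> \<real>"
    proof (rule ccontr)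
      assume nz: "z \<notin> \<real>"
      have "insert z (of_real ` r ` {..<d}) \<subseteq> {z. poly ?P z = 0}"
        using z r(3) by (auto simp: ev)
      moreover have "card (insert z (of_real ` r ` {..<d})) = Suc d"
        using nz inj by (subst card_insert_disjoint) (auto simp: card_image inj_on_def)
      ultimately have "Suc d \<le> card {z. poly ?P z = 0}"
        using card_mono poly_roots_finite[OF P] by metis
      also have "\<dots> \<le> degree ?P"
        using P by (rule card_poly_roots_bound)
      also have "\<dots> \<le> d" using deg by (simp add: degree_map_poly)
      finally show False by simp
    qed
  qed
qed

section \<open>Generating function and Fourier coefficients\<close>

text \<open>
  The coefficients of the logarithm of the generating function, since
  \<open>- ln (1 - q^m) = (\<Sum>j\<ge>1. q^(m j) / j)\<close>. The value at $0$ is $0$ because division by $0$ yields $0$.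
\<close>

definition log_coeff :: "nat \<Rightarrow> nat \<Rightarrow> real" where
  "log_coeff k N = real (divisor_sum k N) / real N"

lemma log_coeff_nonneg: "log_coeff k N \<ge> 0"
  by (simp add: log_coeff_def)

text \<open>There are at most N divisors, each at most N. This crude bound only serves
  convergence.\<close>

lemma log_coeff_le: "log_coeff k N \<le> real N"
proof (cases "N = 0")
  case False
  have "divisor_sum k N \<le> (\<Sum>m | m dvd N \<and> \<not> k dvd m. N)"
    unfolding divisor_sum_def by (intro sum_mono) (use False in \<open>auto intro: dvd_imp_le\<close>)
  also have "\<dots> \<le> (\<Sum>m\<in>{1..N}. N)"
    using False by (intro sum_mono2) (auto simp: Suc_le_eq dvd_imp_le intro!: Nat.gr0I)
  finally have "real (divisor_sum k N) \<le> real (N * N)"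
    by (simp only: of_nat_le_iff) simp
  then show ?thesis
    using False by (simp add: log_coeff_def field_simps)
qed (simp add: log_coeff_def)

section \<open>Exponential bounds and summability\<close>

lemma power_le_fact_mult_exp:
  fixes x :: real
  assumes "x \<ge> 0"
  shows "x ^ q \<le> fact q * exp x"
proof -
  have "(\<lambda>n. x ^ n /\<^sub>R fact n) sums exp x" by (rule exp_converges)
  then have "x ^ q /\<^sub>R fact q \<le> exp x"
    using sum_le_suminf[of "\<lambda>n. x ^ n /\<^sub>R fact n" "{q}"] assms
    by (auto simp: sums_iff)
  then show ?thesis by (simp add: field_simps)
qed

lemma power_exp_minus_le:
  fixes x c :: real
  assumes "x \<ge> 0" "c > 0"
  shows "x ^ q * exp (- (c * x)) \<le> fact q / c ^ q"
proof -
  have "(c * x) ^ q * exp (- (c * x)) \<le> fact q * exp (c * x) * exp (- (c * x))"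
    using assms by (intro mult_right_mono power_le_fact_mult_exp) auto
  then show ?thesis
    using assms by (simp add: exp_minus power_mult_distrib field_simps)
qed

text \<open>Half of the exponential absorbs the power; the other half remains for summation.\<close>

lemma power_exp_le_half:
  fixes x c :: real
  assumes "x \<ge> 0" "c > 0"
  shows "x ^ q * exp (- (c * x)) \<le> fact q * (2 / c) ^ q * exp (- (c / 2 * x))"
proof -
  have "x ^ q * exp (- (c * x)) = (x ^ q * exp (- (c / 2 * x))) * exp (- (c / 2 * x))"
    by (simp add: mult.assoc flip: exp_add)
  also have "\<dots> \<le> (fact q / (c / 2) ^ q) * exp (- (c / 2 * x))"
    using assms by (intro mult_right_mono power_exp_minus_le) auto
  finally show ?thesis by (simp add: power_divide field_simps)
qed

lemma summable_exp_minus: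
  fixes c :: real
  assumes "c > 0"
  shows "summable (\<lambda>n. exp (- (c * real n)))"
proof -
  have "exp (- (c * real n)) = exp (- c) ^ n" for n
    by (simp add: mult.commute flip: exp_of_nat_mult)
  then show ?thesis using assms by (simp add: summable_geometric)
qed

lemma summable_power_exp:
  fixes c :: real
  assumes "c > 0"
  shows "summable (\<lambda>n. real n ^ q * exp (- (c * real n)))"
proof (rule summable_comparison_test')
  show "summable (\<lambda>n. fact q * (2 / c) ^ q * exp (- (c / 2 * real n)))"
    using assms by (intro summable_mult summable_exp_minus) auto
  show "norm (real n ^ q * exp (- (c * real n))) \<le> fact q * (2 / c) ^ q * exp (- (c / 2 * real n))" for n
    using power_exp_le_half[of "real n" c q] assms by simp
qed

lemma summable_log_coeff:
  assumes "c > 0"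
  shows "summable (\<lambda>N. real N ^ q * log_coeff k N * exp (- (c * real N)))"
proof (rule summable_comparison_test')
  show "summable (\<lambda>N. real N ^ Suc q * exp (- (c * real N)))"
    by (rule summable_power_exp[OF assms])
  show "norm (real N ^ q * log_coeff k N * exp (- (c * real N))) \<le> real N ^ Suc q * exp (- (c * real N))" for N
    using mult_left_mono[OF log_coeff_le[of k N], of "real N ^ q"] log_coeff_nonneg[of k N]
    by (simp add: mult.commute)
qed

section \<open>The generating function as an exponential\<close>

definition log_fps :: "nat \<Rightarrow> complex fps" where
  "log_fps k = Abs_fps (\<lambda>N. complex_of_real (log_coeff k N))"

lemma conv_radius_log_fps: "fps_conv_radius (log_fps k) \<ge> 1"
  unfolding fps_conv_radius_def
proof (rule conv_radius_geI_ex')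
  fix r :: real assume r: "0 < r" "ereal r < 1"
  then have "summable (\<lambda>N. real N ^ 0 * log_coeff k N * exp (- (- ln r * real N)))"
    by (intro summable_log_coeff) (auto simp: one_ereal_def)
  moreover have "exp (- (- ln r * real N)) = r ^ N" for N
    using r by (simp add: exp_of_nat2_mult)
  ultimately have "summable (\<lambda>N. log_coeff k N * r ^ N)" by simp
  then have "summable (\<lambda>N. complex_of_real (log_coeff k N * r ^ N))"
    by (simp only: summable_complex_of_real)
  then show "summable (\<lambda>n. fps_nth (log_fps k) n * complex_of_real r ^ n)"
    by (simp add: log_fps_def)
qed

lemma unit_ball_subset_conv_log_fps: "ball (0::complex) 1 \<subseteq> eball 0 (fps_conv_radius (log_fps k))"
proof
  fix z :: complex assume "z \<in> ball 0 1"
  then have "ereal (norm z) < 1" by (simp add: one_ereal_def)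
  also have "\<dots> \<le> fps_conv_radius (log_fps k)" by (rule conv_radius_log_fps)
  finally show "z \<in> eball 0 (fps_conv_radius (log_fps k))" by (simp add: in_eball_iff)
qed

text \<open>
  With $A = \exp B$ one has $A' = B' A$, whose coefficients satisfy the recurrence for the number of
  regular partitions.
\<close>

lemma partition_fps:
  "(\<lambda>z. exp (eval_fps (log_fps k) z)) has_fps_expansion
     Abs_fps (\<lambda>n. of_nat (num_regular_partitions k n))"
proof -
  let ?B = "eval_fps (log_fps k)" and ?A = "\<lambda>z. exp (eval_fps (log_fps k) z)"
  note rad = unit_ball_subset_conv_log_fps[of k]
  have holB: "?B holomorphic_on ball 0 1"
    using rad by (rule holomorphic_on_eval_fps)
  then have holA: "?A holomorphic_on ball 0 1"
    by (rule holomorphic_on_exp')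
  have "?A analytic_on ball 0 1" using holA by (simp add: analytic_on_open)
  then have "?A analytic_on {0}" by (rule analytic_on_subset) simp
  then obtain F where F: "?A has_fps_expansion F"
    using analytic_at_imp_has_fps_expansion_0 by blast
  have B: "?B has_fps_expansion log_fps k"
    by (intro eval_fps_has_fps_expansion less_le_trans[OF _ conv_radius_log_fps]) simp
  have "(\<lambda>z. deriv ?B z * ?A z) has_fps_expansion fps_deriv (log_fps k) * F"
    by (intro has_fps_expansion_mult has_fps_expansion_deriv B F)
  moreover have "eventually (\<lambda>z. deriv ?A z = deriv ?B z * ?A z) (nhds 0)"
  proof -
    have "eventually (\<lambda>z. z \<in> ball (0::complex) 1) (nhds 0)"
      by (intro eventually_nhds_in_open) auto
    then show ?thesis
    proof eventually_elim
      case (elim z)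
      then have "(?B has_field_derivative deriv ?B z) (at z)"
        using holB by (intro holomorphic_derivI) auto
      then have "(?A has_field_derivative ?A z * deriv ?B z) (at z)"
        by (intro DERIV_chain2[OF DERIV_exp])
      then show ?case by (simp add: DERIV_imp_deriv mult.commute)
    qed
  qed
  ultimately have "deriv ?A has_fps_expansion fps_deriv (log_fps k) * F"
    by (subst has_fps_expansion_cong) auto
  then have eq: "fps_deriv F = fps_deriv (log_fps k) * F"
    using has_fps_expansion_deriv[OF F] by (rule fps_expansion_unique_complex[rotated])
  have "fps_nth F n = of_nat (num_regular_partitions k n)" for n
  proof (induction n rule: less_induct)
    case (less n)
    show ?case
    proof (cases n)
      case 0
      have "fps_nth F 0 = ?A 0"
        using has_fps_expansion_imp_0_eq_fps_nth_0[OF F] by simp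
      also have "?B 0 = fps_nth (log_fps k) 0" by (rule eval_fps_at_0)
      finally show ?thesis
        using 0 by (simp add: log_fps_def log_coeff_def num_regular_partitions_0)
    next
      case (Suc m)
      have "of_nat n * fps_nth F n = fps_nth (fps_deriv F) m"
        using Suc by simp
      also have "\<dots> = (\<Sum>i=0..m. of_nat (Suc i) * fps_nth (log_fps k) (Suc i) * fps_nth F (m - i))"
        unfolding eq fps_mult_nth by simp
      also have "\<dots> = (\<Sum>i=0..m. of_nat (divisor_sum k (Suc i) * num_regular_partitions k (n - Suc i)))"
      proof (intro sum.cong refl)
        fix i assume "i \<in> {0..m}"
        then have "fps_nth F (m - i) = of_nat (num_regular_partitions k (n - Suc i))"
          using less.IH[of "m - i"] Suc by simp
        moreover have "of_nat (Suc i) * fps_nth (log_fps k) (Suc i) = of_nat (divisor_sum k (Suc i))"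
          by (simp add: log_fps_def log_coeff_def field_simps del: of_nat_Suc)
        ultimately show "of_nat (Suc i) * fps_nth (log_fps k) (Suc i) * fps_nth F (m - i)
            = of_nat (divisor_sum k (Suc i) * num_regular_partitions k (n - Suc i))"
          by simp
      qed
      also have "\<dots> = of_nat (\<Sum>N=1..n. divisor_sum k N * num_regular_partitions k (n - N))"
        unfolding of_nat_sum One_nat_def Suc
        by (subst sum.atLeast_Suc_atMost_Suc_shift) (simp add: atLeast0AtMost)
      also have "\<dots> = of_nat n * of_nat (num_regular_partitions k n)"
        by (simp only: num_regular_partitions_recurrence[symmetric] of_nat_mult)
      finally show ?thesis using Suc by (simp del: of_nat_Suc)
    qed
  qed
  then have "F = Abs_fps (\<lambda>n. of_nat (num_regular_partitions k n))"
    by (simp add: fps_eq_iff)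
  with F show ?thesis by simp
qed

text \<open>In the unit disc this is the product of 1/(1 - z^m) over all m not divisible by k. The
  exponential form is chosen because its modulus is governed by the real part of a series.\<close>

definition gen_fun :: "nat \<Rightarrow> complex \<Rightarrow> complex" where
  "gen_fun k z = exp (\<Sum>N. of_real (log_coeff k N) * z ^ N)"

text \<open>The expansion at 0 extends to the whole unit disc because the exponential of the
  logarithm series is holomorphic there, which bounds the radius of convergence of its Taylor series
  from below.\<close>

lemma partition_series:
  fixes z :: complex
  assumes "norm z < 1"
  shows "(\<lambda>n. of_nat (num_regular_partitions k n) * z ^ n) sums gen_fun k z"
    and "summable (\<lambda>n. norm (of_nat (num_regular_partitions k n) * z ^ n))"
proof -
  let ?F = "Abs_fps (\<lambda>n. of_nat (num_regular_partitions k n)) :: complex fps"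
  note rad = unit_ball_subset_conv_log_fps[of k]
  have hol: "(\<lambda>z. exp (eval_fps (log_fps k) z)) holomorphic_on eball 0 1"
    using rad by (intro holomorphic_intros holomorphic_on_eval_fps) (simp add: one_ereal_def)
  have "fps_expansion (\<lambda>z. exp (eval_fps (log_fps k) z)) 0 = ?F"
    by (rule fps_expansion_eqI[OF partition_fps])
  then have "1 \<le> fps_conv_radius ?F"
    using conv_radius_fps_expansion[OF hol] by (simp add: one_ereal_def)
  then have rF: "norm z < fps_conv_radius ?F"
    using assms less_le_trans[of "ereal (norm z)" 1] by (simp add: one_ereal_def)
  have "eval_fps ?F z = exp (eval_fps (log_fps k) z)"
    using hol assms by (intro has_fps_expansion_imp_eval_fps_eq[OF partition_fps, of z 1]) (auto simp: one_ereal_def)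
  then show "(\<lambda>n. of_nat (num_regular_partitions k n) * z ^ n) sums gen_fun k z"
    using sums_eval_fps[OF rF] by (simp add: eval_fps_def log_fps_def gen_fun_def)
  show "summable (\<lambda>n. norm (of_nat (num_regular_partitions k n) * z ^ n))"
    using norm_summable_fps[OF rF] by simp
qed


section \<open>Fourier coefficients on a circle\<close>

lemma integral_cis_int:
  "(\<integral>y. indicator {-pi..pi} y *\<^sub>R cis (of_int j * y) \<partial>lborel) = (if j = 0 then 2 * of_real pi else 0)"
proof (cases "j = 0")
  case True
  then show ?thesis
    by (simp add: scaleR_conv_of_real)
next
  case False
  have "(\<integral>y. indicator {-pi..pi} y *\<^sub>R cis (of_int j * y) \<partial>lborel)
      = cis (of_int j * pi) / (\<i> * of_int j) - cis (of_int j * (- pi)) / (\<i> * of_int j)"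
  proof (rule integral_FTC_atLeastAtMost)
    show "((\<lambda>y. cis (of_int j * y) / (\<i> * of_int j)) has_vector_derivative cis (of_int j * x))
           (at x within {- pi..pi})" for x
      unfolding cis_conv_exp has_real_derivative_iff_has_vector_derivative[symmetric] using False
      by (auto intro!: derivative_eq_intros has_vector_derivative_real_field simp: field_simps)
    show "continuous_on {- pi..pi} (\<lambda>y. cis (of_int j * y))"
      by (intro continuous_intros)
  qed simp
  also have "cis (of_int j * pi) = cis (of_int j * (- pi))"
    by (simp add: complex_eq_iff sin_int_times_real mult.commute)
  finally show ?thesis using False by simp
qed

text \<open>Termwise integration is justified by the convergent majorant p_k(m) r^m, uniform in y;
  orthogonality leaves only the term m = n.\<close>

lemma fourier_coeff_partition:
  assumes r: "0 < r" "r < 1"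
  shows "integrable lborel (\<lambda>y. indicator {-pi..pi} y *\<^sub>R (gen_fun k (of_real r * cis y) * cis (- (real n * y))))"
    and "(\<integral>y. indicator {-pi..pi} y *\<^sub>R (gen_fun k (of_real r * cis y) * cis (- (real n * y))) \<partial>lborel)
           = 2 * of_real pi * of_nat (num_regular_partitions k n) * of_real r ^ n"
proof -
  let ?p = "num_regular_partitions k"
  let ?f = "\<lambda>m y. indicator {-pi..pi} y *\<^sub>R (of_nat (?p m) * (of_real r * cis y) ^ m * cis (- (real n * y)))"
  have norm_z: "norm (of_real r * cis y) < 1" for y
    using r by (simp add: norm_mult)
  have int_f: "integrable lborel (?f m)" for m
    by (rule borel_integrable_atLeastAtMost'[unfolded set_integrable_def]) (intro continuous_intros)
  have norm_f: "norm (?f m y) = indicator {-pi..pi} y * (real (?p m) * r ^ m)" for m y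
    using r by (simp add: norm_mult norm_power)
  have sm: "summable (\<lambda>m. real (?p m) * r ^ m)"
    using partition_series(2)[of "of_real r" k] r by (simp add: norm_mult norm_power)
  have sums_f: "(\<lambda>m. ?f m y) sums (indicator {-pi..pi} y *\<^sub>R (gen_fun k (of_real r * cis y) * cis (- (real n * y))))" for y
    by (intro sums_scaleR_right sums_mult2 partition_series(1) norm_z)
  have AE_sm: "AE y in lborel. summable (\<lambda>m. norm (?f m y))"
    unfolding norm_f by (intro AE_I2 summable_mult sm)
  have int_sm: "summable (\<lambda>m. \<integral>y. norm (?f m y) \<partial>lborel)"
    unfolding norm_f using summable_mult[OF sm, of "2 * pi"] by simp
  have eq: "(\<lambda>y. \<Sum>m. ?f m y) = (\<lambda>y. indicator {-pi..pi} y *\<^sub>R (gen_fun k (of_real r * cis y) * cis (- (real n * y))))"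
    using sums_f by (intro ext) (simp add: sums_iff)
  show "integrable lborel (\<lambda>y. indicator {-pi..pi} y *\<^sub>R (gen_fun k (of_real r * cis y) * cis (- (real n * y))))"
    using integrable_suminf[OF int_f AE_sm int_sm] unfolding eq .
  have f_eq: "?f m y = (of_nat (?p m) * of_real r ^ m) * (indicator {-pi..pi} y *\<^sub>R cis (of_int (int m - int n) * y))" for m y
    by (simp add: power_mult_distrib Complex.DeMoivre algebra_simps cis_mult)
  have "(\<integral>y. ?f m y \<partial>lborel) = (if m = n then 2 * of_real pi * of_nat (?p n) * of_real r ^ n else 0)" for m
    unfolding f_eq integral_mult_right_zero integral_cis_int by simp
  then have "(\<lambda>m. \<integral>y. ?f m y \<partial>lborel) sums (2 * of_real pi * of_nat (?p n) * of_real r ^ n)"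
    using sums_single[of n "\<lambda>_. 2 * of_real pi * of_nat (?p n) * complex_of_real r ^ n"] by simp
  moreover have "(\<lambda>m. \<integral>y. ?f m y \<partial>lborel) sums (\<integral>y. (\<Sum>m. ?f m y) \<partial>lborel)"
    by (rule sums_integral[OF int_f AE_sm int_sm])
  ultimately show "(\<integral>y. indicator {-pi..pi} y *\<^sub>R (gen_fun k (of_real r * cis y) * cis (- (real n * y))) \<partial>lborel)
           = 2 * of_real pi * of_nat (num_regular_partitions k n) * of_real r ^ n"
    unfolding eq by (rule sums_unique2[symmetric])
qed

text \<open>In the binomial expansion the j-th term shifts the frequency from n to n + j, and
  (X/r)^j turns the resulting r^(n+j) into r^n X^j.\<close>

lemma jensen_poly_integral:
  fixes X r :: real
  assumes r: "0 < r" "r < 1"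
  shows "(\<integral>y. indicator {-pi..pi} y *\<^sub>R (gen_fun k (of_real r * cis y) * cis (- (real n * y)) * (1 + of_real (X / r) * cis (- y)) ^ d) \<partial>lborel)
     = of_real (2 * pi * r ^ n * poly (jensen_poly (\<lambda>m. real (num_regular_partitions k m)) d n) X)"
proof -
  let ?p = "num_regular_partitions k"
  let ?g = "\<lambda>m y. indicator {-pi..pi} y *\<^sub>R (gen_fun k (of_real r * cis y) * cis (- (real m * y)))"
  have "indicator {-pi..pi} y *\<^sub>R (gen_fun k (of_real r * cis y) * cis (- (real n * y)) * (1 + of_real (X / r) * cis (- y)) ^ d)
      = (\<Sum>j\<le>d. (of_nat (d choose j) * of_real (X / r) ^ j) * ?g (n + j) y)" for y
  proof -
    have "(1 + of_real (X / r) * cis (- y)) ^ d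
        = (\<Sum>j\<le>d. of_nat (d choose j) * of_real (X / r) ^ j * cis (- (real j * y)))"
      by (subst add.commute, subst binomial_ring) (simp add: power_mult_distrib power_divide mult.assoc Complex.DeMoivre)
    moreover have "cis (- (real (n + j) * y)) = cis (- (real n * y)) * cis (- (real j * y))" for j
      by (simp add: cis_mult algebra_simps)
    ultimately show ?thesis
      by (simp add: sum_distrib_left scaleR_sum_right mult_ac)
  qed
  then have "(\<integral>y. indicator {-pi..pi} y *\<^sub>R (gen_fun k (of_real r * cis y) * cis (- (real n * y)) * (1 + of_real (X / r) * cis (- y)) ^ d) \<partial>lborel)
      = (\<integral>y. (\<Sum>j\<le>d. (of_nat (d choose j) * of_real (X / r) ^ j) * ?g (n + j) y) \<partial>lborel)"
    by (simp only:)
  also have "\<dots> = (\<Sum>j\<le>d. (\<integral>y. (of_nat (d choose j) * of_real (X / r) ^ j) * ?g (n + j) y \<partial>lborel))"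
    by (intro Bochner_Integration.integral_sum integrable_mult_right fourier_coeff_partition(1) r)
  also have "\<dots> = (\<Sum>j\<le>d. (of_nat (d choose j) * of_real (X / r) ^ j) * (\<integral>y. ?g (n + j) y \<partial>lborel))"
    by (simp only: integral_mult_right_zero)
  also have "\<dots> = (\<Sum>j\<le>d. of_real (2 * pi * r ^ n * (real (d choose j) * real (?p (n + j)) * X ^ j)))"
    using r unfolding fourier_coeff_partition(2)[OF r]
    by (intro sum.cong refl) (simp add: power_add power_divide field_simps)
  also have "\<dots> = of_real (2 * pi * r ^ n * poly (jensen_poly (\<lambda>m. real (?p m)) d n) X)"
    by (simp add: jensen_poly_def poly_sum poly_monom sum_distrib_left atLeast0AtMost)
  finally show ?thesis .
qed

section \<open>Exponential sums over integers not divisible by k\<close>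

text \<open>In 1 - w^m = (1 - w)(1 + w + ... + w^(m-1)) the second factor differs from m by at most
  m^2 |1 - w| / 2, hence by at most m/2.\<close>

lemma norm_one_minus_power_ge:
  fixes w :: complex
  assumes w: "norm w = 1" and m: "real m * norm (1 - w) \<le> 1"
  shows "norm (1 - w ^ m) \<ge> real m / 2 * norm (1 - w)"
proof -
  have gauss: "(\<Sum>i<m. real i) \<le> real m * real m / 2"
    by (induction m) (auto simp: field_simps)
  have "norm (of_nat m - (\<Sum>i<m. w ^ i)) = norm (\<Sum>i<m. 1 - w ^ i)"
    by (simp add: sum_subtractf)
  also have "\<dots> \<le> (\<Sum>i<m. real i * norm (1 - w))"
    using norm_power_diff[of 1 w] w by (intro sum_norm_le) (simp del: norm_minus_commute)
  also have "\<dots> \<le> real m * real m / 2 * norm (1 - w)"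
    unfolding sum_distrib_right[symmetric] using gauss by (rule mult_right_mono) simp
  also have "\<dots> = real m / 2 * (real m * norm (1 - w))" by simp
  also have "\<dots> \<le> real m / 2"
    using m mult_left_mono[of "real m * norm (1 - w)" 1 "real m / 2"] by simp
  finally have "norm (\<Sum>i<m. w ^ i) \<ge> real m / 2"
    using norm_triangle_ineq2[of "of_nat m" "of_nat m - (\<Sum>i<m. w ^ i)"] by simp
  then have "norm (1 - w) * norm (\<Sum>i<m. w ^ i) \<ge> norm (1 - w) * (real m / 2)"
    by (intro mult_left_mono) auto
  then show ?thesis
    by (simp add: one_diff_power_eq norm_mult mult.commute)
qed

lemma norm_one_minus_squared:
  fixes z :: complex
  assumes "norm z = 1"
  shows "(norm (1 - z))\<^sup>2 = 2 - 2 * Re z"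
proof -
  have "(Re z)\<^sup>2 + (Im z)\<^sup>2 = 1"
    using assms by (simp flip: cmod_power2)
  moreover have "(norm (1 - z))\<^sup>2 = (1 - Re z)\<^sup>2 + (Im z)\<^sup>2"
    by (simp add: cmod_power2)
  ultimately show ?thesis
    by (simp add: power2_eq_square algebra_simps)
qed

lemma sum_squares_Suc_ge: "(\<Sum>l<K. real (l + 1) ^ 2) \<ge> real K ^ 3 / 3"
  by (induction K) (auto simp: field_simps power2_eq_square power3_eq_cube)

text \<open>
  Three regimes, with $u = w^k$: if $w$ is within $O(1/L)$ of $1$, the terms grow like $(l + 1)^2 |1 - w|^2$;
  if $u$ is not within $O(1/L)$ of $1$, the geometric sum oscillates; in the remaining case $w$ is
  close to a nontrivial $k$-th root of unity, so that a positive proportion of the $w^{kl+1}$ stays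
  away from $1$.
\<close>

lemma progression_sum_ge:
  fixes w :: complex
  assumes k: "k \<ge> 1" and L: "L \<ge> 32" and w: "norm w = 1"
  shows "(\<Sum>l<L. (norm (1 - w ^ (k * l + 1)))\<^sup>2)
           \<ge> min (real L) (real L ^ 3 * (norm (1 - w))\<^sup>2) / (393216 * real k ^ 3)"
proof -
  define \<delta> where "\<delta> = norm (1 - w)"
  define u where "u = w ^ k"
  let ?E = "\<lambda>l. (norm (1 - w ^ (k * l + 1)))\<^sup>2"
  have u: "norm u = 1" using w by (simp add: u_def norm_power)
  have Lpos: "real L > 0" using L by simp
  have \<delta>: "\<delta> \<ge> 0" by (simp add: \<delta>_def)
  have pow: "w ^ (k * l + 1) = w * u ^ l" for l
    by (simp add: u_def power_mult)
  have k1: "real k \<ge> 1" "real k ^ 3 \<ge> 1" using k by simp_all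
  consider (near) "\<delta> * (real k * real L) \<le> 16"
    | (osc) "norm (1 - u) \<ge> 4 / real L"
    | (root) "norm (1 - u) < 4 / real L" "\<delta> > 1 / real k"
  proof -
    \<comment> \<open>The three cases are exhaustive: for 16/(k L) < \<delta> \<le> 1/k the power k
      multiplies the distance to 1 by at least k/2, giving at least 8/L.\<close>
    have "norm (1 - u) \<ge> 4 / real L" if "\<delta> * (real k * real L) > 16" "\<delta> \<le> 1 / real k"
    proof -
      have "norm (1 - u) \<ge> real k / 2 * \<delta>"
        unfolding u_def \<delta>_def
        by (rule norm_one_minus_power_ge[OF w]) (use that(2) k1 in \<open>simp add: \<delta>_def field_simps\<close>)
      moreover have "real k / 2 * \<delta> \<ge> 4 / real L"
        using that(1) Lpos by (simp add: field_simps)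
      ultimately show ?thesis by linarith
    qed
    then show ?thesis using that by linarith
  qed
  then show ?thesis
  proof cases
    case near
    \<comment> \<open>For l < K one has (k l + 1) \<delta> \<le> k K \<delta> \<le> k L \<delta> /
      16 \<le> 1, the condition under which |1 - w^(kl+1)| is at least (k l + 1) \<delta> /
      2.\<close>
    define K where "K = L div 16"
    have KL: "real K \<ge> real L / 32" "16 * real K \<le> real L"
      using L unfolding K_def by linarith+
    have E: "?E l \<ge> real (l + 1) ^ 2 * (\<delta>\<^sup>2 / 4)" if "l < K" for l
    proof -
      have "real (k * l + 1) \<le> real k * (real l + 1)" using k1 by (simp add: field_simps)
      also have "\<dots> \<le> real k * real K" using that k1 by (intro mult_left_mono) auto
      finally have "real (k * l + 1) * \<delta> \<le> real k * real K * \<delta>"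
        using \<delta> by (intro mult_right_mono) auto
      also have "\<dots> \<le> real k * (real L / 16) * \<delta>"
        using KL \<delta> k1 by (intro mult_right_mono mult_left_mono) auto
      also have "\<dots> \<le> 1" using near by (simp add: field_simps)
      finally have "norm (1 - w ^ (k * l + 1)) \<ge> real (k * l + 1) / 2 * \<delta>"
        unfolding \<delta>_def by (rule norm_one_minus_power_ge[OF w])
      moreover have "real (k * l + 1) / 2 * \<delta> \<ge> real (l + 1) / 2 * \<delta>"
        using k1 \<delta> mult_right_mono[of 1 "real k" "real l"] by (intro mult_right_mono divide_right_mono) auto
      ultimately have "?E l \<ge> (real (l + 1) / 2 * \<delta>)\<^sup>2"
        using \<delta> by (intro power_mono) auto
      then show ?thesis by (simp add: power_mult_distrib power_divide)
    qed
    \<comment> \<open>The constant is 32^3 * 3 * 4: from K \<ge> L/32, the sum of squares, and the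
      squared factor 1/2.\<close>
    have "real L ^ 3 * \<delta>\<^sup>2 / 393216 = (real L / 32) ^ 3 / 3 * (\<delta>\<^sup>2 / 4)"
      by (simp add: power_divide)
    also have "\<dots> \<le> real K ^ 3 / 3 * (\<delta>\<^sup>2 / 4)"
      using KL by (intro mult_right_mono divide_right_mono power_mono) auto
    also have "\<dots> \<le> (\<Sum>l<K. real (l + 1) ^ 2) * (\<delta>\<^sup>2 / 4)"
      using sum_squares_Suc_ge by (intro mult_right_mono) auto
    also have "\<dots> \<le> (\<Sum>l<K. ?E l)"
      unfolding sum_distrib_right by (intro sum_mono E) auto
    also have "\<dots> \<le> (\<Sum>l<L. ?E l)"
      by (intro sum_mono2) (auto simp: K_def)
    finally have *: "real L ^ 3 * \<delta>\<^sup>2 / 393216 \<le> (\<Sum>l<L. ?E l)" .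
    have "min (real L) (real L ^ 3 * \<delta>\<^sup>2) / (393216 * real k ^ 3) \<le> real L ^ 3 * \<delta>\<^sup>2 / (393216 * real k ^ 3)"
      using k1 by (intro divide_right_mono) auto
    also have "\<dots> \<le> real L ^ 3 * \<delta>\<^sup>2 / 393216"
      using k1 by (intro divide_left_mono) auto
    finally show ?thesis using * by (simp add: \<delta>_def)
  next
    case osc
    then have "1 - u \<noteq> 0" using Lpos by (auto simp: field_simps)
    \<comment> \<open>The geometric sum has modulus at most L/2, whereas the sum of the squared
      distances is 2 L minus twice its real part.\<close>
    have "norm (\<Sum>l<L. w ^ (k * l + 1)) = norm (\<Sum>l<L. u ^ l)"
      unfolding pow using w by (simp add: norm_mult flip: sum_distrib_left)
    also have "\<dots> = norm (1 - u ^ L) / norm (1 - u)"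
      using \<open>1 - u \<noteq> 0\<close> by (simp add: one_diff_power_eq norm_mult)
    also have "\<dots> \<le> 2 / norm (1 - u)"
      using norm_triangle_ineq4[of 1 "u ^ L"] u by (intro divide_right_mono) (auto simp: norm_power)
    also have "\<dots> \<le> 2 / (4 / real L)"
      using osc Lpos \<open>1 - u \<noteq> 0\<close> by (intro divide_left_mono mult_pos_pos) auto
    finally have "Re (\<Sum>l<L. w ^ (k * l + 1)) \<le> real L / 2"
      using complex_Re_le_cmod[of "\<Sum>l<L. w ^ (k * l + 1)"] by simp
    moreover have "(\<Sum>l<L. ?E l) = 2 * real L - 2 * Re (\<Sum>l<L. w ^ (k * l + 1))"
      using w by (simp add: norm_one_minus_squared norm_mult norm_power sum_subtractf flip: sum_distrib_left)
    ultimately have *: "(\<Sum>l<L. ?E l) \<ge> real L" by linarith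
    have "min (real L) (real L ^ 3 * \<delta>\<^sup>2) / (393216 * real k ^ 3) \<le> real L / (393216 * real k ^ 3)"
      using k1 by (intro divide_right_mono) auto
    also have "\<dots> \<le> real L / 1"
    proof (rule divide_left_mono)
      show "1 \<le> 393216 * real k ^ 3" using k1(2) by linarith
    qed (use k1 in auto)
    finally show ?thesis using * by (simp add: \<delta>_def)
  next
    case root
    \<comment> \<open>For l < K the drift |1 - u^l| is at most 4 l / L \<le> 1/(2 k), while |1 - w|
      > 1/k; so w u^l stays at distance at least 1/(2 k) from 1. The summand 1 compensates for
      rounding and gives K \<ge> L/(8 k).\<close>
    define K where "K = L div (8 * k) + 1"
    have "L div (8 * k) \<le> L div 8" using k by (intro div_le_mono2) auto
    then have KL: "K \<le> L" using L unfolding K_def by linarith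
    have K: "real K \<ge> real L / (8 * real k)"
    proof -
      have "L < (8 * k) * K" using k unfolding K_def by (simp add: dividend_less_times_div)
      then have "real L < 8 * real k * real K"
        by (metis of_nat_less_iff of_nat_mult of_nat_numeral)
      then show ?thesis using k1 by (simp add: field_simps)
    qed
    have E: "?E l \<ge> 1 / (4 * real k ^ 2)" if "l < K" for l
    proof -
      have "8 * k * l \<le> 8 * k * (L div (8 * k))" using that by (intro mult_left_mono) (auto simp: K_def)
      also have "\<dots> \<le> L" by (rule times_div_less_eq_dividend)
      finally have lL: "8 * real k * real l \<le> real L"
        by (metis of_nat_le_iff of_nat_mult of_nat_numeral)
      have "w - w * u ^ l = w * (1 - u ^ l)" by (simp add: algebra_simps)
      then have "norm (w - w * u ^ l) = norm (1 - u ^ l)" by (simp add: norm_mult w)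
      also have "\<dots> \<le> real l * norm (1 - u)"
        using norm_power_diff[of 1 u l] u by simp
      also have "\<dots> \<le> real l * (4 / real L)"
        using root by (intro mult_left_mono) auto
      also have "\<dots> \<le> 1 / (2 * real k)"
        using lL Lpos k1 by (simp add: field_simps)
      finally have "norm (w - w * u ^ l) \<le> 1 / (2 * real k)" .
      moreover have "norm (1 - w) \<le> norm (1 - w * u ^ l) + norm (w - w * u ^ l)"
        using norm_triangle_ineq4[of "1 - w * u ^ l" "w - w * u ^ l"] by simp
      ultimately have "norm (1 - w ^ (k * l + 1)) \<ge> 1 / (2 * real k)"
        using root(2) unfolding pow \<delta>_def by (simp add: field_simps)
      then have "?E l \<ge> (1 / (2 * real k))\<^sup>2" by (intro power_mono) auto
      then show ?thesis by (simp add: power_mult_distrib power_divide)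
    qed
    have "real L / (32 * real k ^ 3) = real L / (8 * real k) * (1 / (4 * real k ^ 2))"
      using k1 by (simp add: power2_eq_square power3_eq_cube)
    also have "\<dots> \<le> real K * (1 / (4 * real k ^ 2))"
      using K by (intro mult_right_mono) auto
    also have "\<dots> = (\<Sum>l<K. 1 / (4 * real k ^ 2))" by simp
    also have "\<dots> \<le> (\<Sum>l<K. ?E l)" by (intro sum_mono E) auto
    also have "\<dots> \<le> (\<Sum>l<L. ?E l)" using KL by (intro sum_mono2) auto
    finally have *: "real L / (32 * real k ^ 3) \<le> (\<Sum>l<L. ?E l)" .
    have "min (real L) (real L ^ 3 * \<delta>\<^sup>2) / (393216 * real k ^ 3) \<le> real L / (393216 * real k ^ 3)"
      using k1 by (intro divide_right_mono) auto
    also have "\<dots> \<le> real L / (32 * real k ^ 3)"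
      using k1 by (intro divide_left_mono) auto
    finally show ?thesis using * by (simp add: \<delta>_def)
  qed
qed

text \<open>Since k \<ge> 2, the numbers k l + 1 are not divisible by k, and l < M div k keeps them
  at most M.\<close>

lemma sum_progression_le:
  fixes f :: "nat \<Rightarrow> real"
  assumes k: "k \<ge> 2" and f: "\<And>m. f m \<ge> 0"
  shows "(\<Sum>l<M div k. f (k * l + 1)) \<le> (\<Sum>m | m \<in> {1..M} \<and> \<not> k dvd m. f m)"
proof -
  have "(\<Sum>l<M div k. f (k * l + 1)) = (\<Sum>m\<in>(\<lambda>l. k * l + 1) ` {..<M div k}. f m)"
    using k by (subst sum.reindex) (auto simp: inj_on_def)
  also have "\<dots> \<le> (\<Sum>m | m \<in> {1..M} \<and> \<not> k dvd m. f m)"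
  proof (rule sum_mono2)
    show "(\<lambda>l. k * l + 1) ` {..<M div k} \<subseteq> {m. m \<in> {1..M} \<and> \<not> k dvd m}"
    proof clarify
      fix l assume "l < M div k"
      then have "k * Suc l \<le> k * (M div k)" by (intro mult_le_mono2) auto
      also have "\<dots> \<le> M" by simp
      finally have "k * l + 1 \<le> M" using k by simp
      moreover have "\<not> k dvd k * l + 1"
        using k dvd_add_right_iff[of k "k * l" 1] by auto
      ultimately show "k * l + 1 \<in> {1..M} \<and> \<not> k dvd k * l + 1" by simp
    qed
  qed (auto simp: f)
  finally show ?thesis .
qed

lemma div_ge_half:
  assumes k: "k \<ge> 1" and M: "M \<ge> k"
  shows "real M / (2 * real k) \<le> real (M div k)"
proof -
  have "M div k \<ge> 1" using assms by (simp add: div_greater_zero_iff Suc_le_eq)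
  have "M < k * (M div k + 1)" using k by (simp add: dividend_less_times_div)
  also have "\<dots> \<le> k * (2 * (M div k))" using \<open>M div k \<ge> 1\<close> by (intro mult_left_mono) auto
  finally have "real M \<le> real (k * (2 * (M div k)))" by (simp only: of_nat_le_iff)
  then show ?thesis using k by (simp add: field_simps)
qed

text \<open>The progression has L = M div k \<ge> M/(2 k) terms. Replacing L by M costs a factor (2
  k)^3, whence k^6 and 3145728 = 8 * 393216.\<close>

lemma regular_character_sum_ge:
  fixes w :: complex
  assumes k: "k \<ge> 2" and M: "M \<ge> 64 * k" and w: "norm w = 1"
  shows "(\<Sum>m | m \<in> {1..M} \<and> \<not> k dvd m. (norm (1 - w ^ m))\<^sup>2)
           \<ge> min (real M) (real M ^ 3 * (norm (1 - w))\<^sup>2) / (3145728 * real k ^ 6)"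
proof -
  define L where "L = M div k"
  have "L \<ge> 64 * k div k" unfolding L_def using M by (rule div_le_mono)
  then have L64: "L \<ge> 64" using k by simp
  have LM: "real M / (2 * real k) \<le> real L"
    unfolding L_def using k M by (intro div_ge_half) auto
  have k1: "real k \<ge> 1" using k by simp
  define x where "x = (norm (1 - w))\<^sup>2"
  have x: "x \<ge> 0" by (simp add: x_def)
  have "min (real M) (real M ^ 3 * x) / (8 * real k ^ 3) \<le> min (real L) (real L ^ 3 * x)"
  proof (rule min.boundedI)
    have "min (real M) (real M ^ 3 * x) / (8 * real k ^ 3) \<le> real M / (8 * real k ^ 3)"
      using k1 by (intro divide_right_mono) auto
    also have "\<dots> \<le> real M / (2 * real k)"
    proof (intro divide_left_mono)
      show "2 * real k \<le> 8 * real k ^ 3"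
        using self_le_power[OF k1, of 3] by linarith
    qed (use k1 in auto)
    finally show "min (real M) (real M ^ 3 * x) / (8 * real k ^ 3) \<le> real L" using LM by simp
    have "min (real M) (real M ^ 3 * x) / (8 * real k ^ 3) \<le> real M ^ 3 * x / (8 * real k ^ 3)"
      using k1 by (intro divide_right_mono) auto
    also have "\<dots> = (real M / (2 * real k)) ^ 3 * x"
      by (simp add: power_divide power_mult_distrib)
    also have "\<dots> \<le> real L ^ 3 * x"
      using LM x by (intro mult_right_mono power_mono) auto
    finally show "min (real M) (real M ^ 3 * x) / (8 * real k ^ 3) \<le> real L ^ 3 * x" .
  qed
  then have "min (real M) (real M ^ 3 * x) / (8 * real k ^ 3) / (393216 * real k ^ 3)
      \<le> min (real L) (real L ^ 3 * x) / (393216 * real k ^ 3)"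
    by (rule divide_right_mono) simp
  also have "\<dots> \<le> (\<Sum>l<L. (norm (1 - w ^ (k * l + 1)))\<^sup>2)"
    unfolding x_def using k L64 w by (intro progression_sum_ge) auto
  also have "\<dots> \<le> (\<Sum>m | m \<in> {1..M} \<and> \<not> k dvd m. (norm (1 - w ^ m))\<^sup>2)"
    unfolding L_def using k by (intro sum_progression_le) auto
  finally show ?thesis
    by (simp add: x_def power_add[of "real k" 3 3, simplified] mult_ac)
qed

section \<open>Cumulants and the saddle point\<close>

text \<open>
  For $q \ge 1$ these are the cumulants of the random integer with weights proportional to
  $p_k(m) e^{-\eta m}$; for $q = 0$ it is the logarithm of the normalising factor.
\<close>

definition cumulant :: "nat \<Rightarrow> nat \<Rightarrow> real \<Rightarrow> real" where
  "cumulant k q \<eta> = (\<Sum>N. real N ^ q * log_coeff k N * exp (- (\<eta> * real N)))"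

section \<open>Upper bounds for the cumulants\<close>

lemma sum_exp_minus_le:
  fixes c :: real
  assumes "c > 0"
  shows "(\<Sum>m=1..K. exp (- (c * real m))) \<le> 1 / c"
proof -
  have "(\<Sum>m=1..K. exp (- (c * real m))) \<le> (1 - exp (- (c * real K))) / c"
  proof (induction K)
    case (Suc K)
    have "c * exp (- (c * real (Suc K))) \<le> (exp c - 1) * exp (- (c * real (Suc K)))"
      using exp_ge_add_one_self[of c] by (intro mult_right_mono) (linarith, simp)
    also have "\<dots> = exp (- (c * real K)) - exp (- (c * real (Suc K)))"
      by (simp add: left_diff_distrib algebra_simps flip: exp_add)
    finally have "exp (- (c * real (Suc K))) \<le> (exp (- (c * real K)) - exp (- (c * real (Suc K)))) / c"
      using assms by (simp add: field_simps)
    then show ?case using Suc by (simp add: diff_divide_distrib)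
  qed simp
  also have "\<dots> \<le> 1 / c" using assms by (intro divide_right_mono) auto
  finally show ?thesis .
qed

lemma sum_power_exp_le:
  fixes u :: real
  assumes u: "u > 0"
  shows "(\<Sum>m=1..K. real m ^ q * exp (- (u * real m))) \<le> fact q * (2 / u) ^ Suc q"
proof -
  have "(\<Sum>m=1..K. real m ^ q * exp (- (u * real m)))
      \<le> (\<Sum>m=1..K. fact q * (2 / u) ^ q * exp (- (u / 2 * real m)))"
    using u by (intro sum_mono power_exp_le_half) auto
  also have "\<dots> \<le> fact q * (2 / u) ^ q * (1 / (u / 2))"
    unfolding sum_distrib_left[symmetric] using u by (intro mult_left_mono sum_exp_minus_le) auto
  finally show ?thesis by (simp add: mult_ac)
qed

lemma sum_inverse_squares_le: "(\<Sum>j=1..K. 1 / real j ^ 2) \<le> 2"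
proof -
  have "(\<Sum>j=1..K. 1 / real j ^ 2) \<le> 2 - 1 / real K"
  proof (induction K)
    case (Suc K)
    show ?case
    proof (cases "K = 0")
      case False
      then have "1 / real (Suc K) ^ 2 \<le> 1 / real K - 1 / real (Suc K)"
      proof -
        have "1 / real (Suc K) ^ 2 \<le> 1 / (real K * real (Suc K))"
          using False by (intro divide_left_mono) (auto simp: power2_eq_square)
        also have "\<dots> = 1 / real K - 1 / real (Suc K)"
          using False by (simp add: field_simps)
        finally show ?thesis .
      qed
      then show ?thesis using Suc by simp
    qed simp
  qed simp
  also have "\<dots> \<le> 2" by simp
  finally show ?thesis .
qed

text \<open>Write N = m j. All terms are nonnegative, so the pairs may be extended to a full square;
  the sum over m is then O((\<eta> j)^(-q-2)), and the factor j^q leaves the convergent sum of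
  1/j^2.\<close>

lemma cumulant_le:
  assumes \<eta>: "\<eta> > 0"
  shows "cumulant k (Suc q) \<eta> \<le> 2 * fact (Suc q) * (2 / \<eta>) ^ (q + 2)"
  unfolding cumulant_def
proof (rule suminf_le_const)
  show "summable (\<lambda>N. real N ^ Suc q * log_coeff k N * exp (- (\<eta> * real N)))"
    by (rule summable_log_coeff[OF \<eta>])
  fix K
  let ?P = "{(m, j). 0 < j \<and> \<not> k dvd m \<and> m * j \<le> K \<and> 0 < m}"
  have "(\<Sum>N<K. real N ^ Suc q * log_coeff k N * exp (- (\<eta> * real N)))
      \<le> (\<Sum>N\<in>insert 0 {1..K}. real N ^ Suc q * log_coeff k N * exp (- (\<eta> * real N)))"
    by (intro sum_mono2) (auto simp: log_coeff_nonneg)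
  \<comment> \<open>The term N = 0 vanishes because the exponent \<open>Suc q\<close> is
    positive.\<close>
  also have "\<dots> = (\<Sum>N=1..K. real N ^ Suc q * log_coeff k N * exp (- (\<eta> * real N)))"
    by (subst sum.insert) auto
  also have "\<dots> = (\<Sum>N=1..K. \<Sum>m | m dvd N \<and> \<not> k dvd m. real m * (real N ^ q * exp (- (\<eta> * real N))))"
  proof (rule sum.cong[OF refl])
    fix N assume "N \<in> {1..K}"
    then have "real N * log_coeff k N = (\<Sum>m | m dvd N \<and> \<not> k dvd m. real m)"
      by (simp add: log_coeff_def divisor_sum_def)
    moreover have "real N ^ Suc q * log_coeff k N * exp (- (\<eta> * real N))
      = (real N * log_coeff k N) * (real N ^ q * exp (- (\<eta> * real N)))"
      by simp
    ultimately have "real N ^ Suc q * log_coeff k N * exp (- (\<eta> * real N))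
      = (\<Sum>m | m dvd N \<and> \<not> k dvd m. real m) * (real N ^ q * exp (- (\<eta> * real N)))"
      by (simp only:)
    then show "real N ^ Suc q * log_coeff k N * exp (- (\<eta> * real N))
      = (\<Sum>m | m dvd N \<and> \<not> k dvd m. real m * (real N ^ q * exp (- (\<eta> * real N))))"
      by (simp only: sum_distrib_right)
  qed
  also have "\<dots> = (\<Sum>(m, j)\<in>?P. real m * (real (m * j) ^ q * exp (- (\<eta> * real (m * j)))))"
    by (rule sum_divisors_eq)
  also have "\<dots> \<le> (\<Sum>(m, j)\<in>{1..K} \<times> {1..K}. real m * (real (m * j) ^ q * exp (- (\<eta> * real (m * j)))))"
    by (rule sum_mono2[OF _ factor_pairs_subset]) auto
  also have "\<dots> = (\<Sum>j=1..K. real j ^ q * (\<Sum>m=1..K. real m ^ Suc q * exp (- (\<eta> * real j * real m))))"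
    by (subst sum.cartesian_product[symmetric], subst sum.swap)
      (simp add: sum_distrib_left power_mult_distrib mult_ac)
  also have "\<dots> \<le> (\<Sum>j=1..K. real j ^ q * (fact (Suc q) * (2 / (\<eta> * real j)) ^ Suc (Suc q)))"
    using \<eta> by (intro sum_mono mult_left_mono sum_power_exp_le) auto
  also have "\<dots> = (\<Sum>j=1..K. fact (Suc q) * (2 / \<eta>) ^ (q + 2) * (1 / real j ^ 2))"
    using \<eta> by (intro sum.cong refl) (simp add: power_divide power_mult_distrib power2_eq_square field_simps)
  also have "\<dots> \<le> fact (Suc q) * (2 / \<eta>) ^ (q + 2) * 2"
    unfolding sum_distrib_left[symmetric] using \<eta> by (intro mult_left_mono sum_inverse_squares_le) auto
  finally show "(\<Sum>N<K. real N ^ Suc q * log_coeff k N * exp (- (\<eta> * real N))) \<le> 2 * fact (Suc q) * (2 / \<eta>) ^ (q + 2)"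
    by (simp only: mult_ac)
qed

section \<open>Lower bounds for the cumulants and solution of the saddle point equation\<close>

lemma log_coeff_ge_1:
  assumes "0 < N" "\<not> k dvd N"
  shows "log_coeff k N \<ge> 1"
proof -
  have "N = (\<Sum>m\<in>{N}. m)" by simp
  also have "\<dots> \<le> divisor_sum k N"
    unfolding divisor_sum_def using assms by (intro sum_mono2) auto
  finally show ?thesis using assms by (simp add: log_coeff_def)
qed

text \<open>Only the N \<le> M not divisible by k are kept: there \<open>log_coeff k N\<close> is at
  least 1, since N is one of its own admissible divisors, and the exponential is at least
  1/e.\<close>

lemma weighted_suminf_ge:
  fixes f :: "nat \<Rightarrow> real"
  assumes \<eta>: "\<eta> > 0" and M: "\<eta> * real M \<le> 1" and f: "\<And>m. f m \<ge> 0"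
    and summable: "summable (\<lambda>N. f N * log_coeff k N * exp (- (\<eta> * real N)))"
  shows "(\<Sum>N. f N * log_coeff k N * exp (- (\<eta> * real N)))
    \<ge> exp (- 1) * (\<Sum>m | m \<in> {1..M} \<and> \<not> k dvd m. f m)"
proof -
  have "exp (- 1) * (\<Sum>m | m \<in> {1..M} \<and> \<not> k dvd m. f m)
      \<le> (\<Sum>m | m \<in> {1..M} \<and> \<not> k dvd m. f m * log_coeff k m * exp (- (\<eta> * real m)))"
    unfolding sum_distrib_left
  proof (rule sum_mono)
    fix m assume m: "m \<in> {m. m \<in> {1..M} \<and> \<not> k dvd m}"
    then have "\<eta> * real m \<le> \<eta> * real M" using \<eta> by (intro mult_left_mono) auto
    then have "exp (- 1) \<le> exp (- (\<eta> * real m))" using M by simp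
    moreover have "f m * 1 \<le> f m * log_coeff k m"
      using m f by (intro mult_left_mono log_coeff_ge_1) auto
    ultimately have "f m * 1 * exp (- 1) \<le> f m * log_coeff k m * exp (- (\<eta> * real m))"
      using mult_nonneg_nonneg[OF f[of m] log_coeff_nonneg[of k m]]
      by (intro mult_mono[of "f m * 1"] exp_ge_zero)
    then show "exp (- 1) * f m \<le> f m * log_coeff k m * exp (- (\<eta> * real m))" by (simp add: mult.commute)
  qed
  also have "\<dots> \<le> (\<Sum>N. f N * log_coeff k N * exp (- (\<eta> * real N)))"
    using f log_coeff_nonneg by (intro sum_le_suminf summable) auto
  finally show ?thesis .
qed

lemma cumulant_2_ge:
  assumes k: "k \<ge> 2" and \<eta>: "\<eta> > 0" and M: "\<eta> * real M \<le> 1" "M \<ge> k"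
  shows "cumulant k 2 \<eta> \<ge> exp (- 1) * real M ^ 3 / (24 * real k ^ 3)"
proof -
  have "real M ^ 3 / (24 * real k ^ 3) = (real M / (2 * real k)) ^ 3 / 3"
    by (simp add: power_divide power_mult_distrib)
  also have "\<dots> \<le> real (M div k) ^ 3 / 3"
    using k M(2) by (intro divide_right_mono power_mono div_ge_half) auto
  also have "\<dots> \<le> (\<Sum>l<M div k. real (l + 1) ^ 2)" by (rule sum_squares_Suc_ge)
  also have "\<dots> \<le> (\<Sum>l<M div k. real (k * l + 1) ^ 2)"
  proof (intro sum_mono power_mono)
    show "real (l + 1) \<le> real (k * l + 1)" for l
      unfolding of_nat_le_iff using k by simp
  qed auto
  also have "\<dots> \<le> (\<Sum>m | m \<in> {1..M} \<and> \<not> k dvd m. real m ^ 2)"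
    using k by (intro sum_progression_le) auto
  finally have "exp (- 1) * (real M ^ 3 / (24 * real k ^ 3)) \<le> exp (- 1) * (\<Sum>m | m \<in> {1..M} \<and> \<not> k dvd m. real m ^ 2)"
    by (intro mult_left_mono) auto
  also have "\<dots> \<le> cumulant k 2 \<eta>"
    unfolding cumulant_def by (intro weighted_suminf_ge \<eta> M(1) summable_log_coeff) auto
  finally show ?thesis by simp
qed

lemma cumulant_antimono:
  assumes "0 < a" "a \<le> b"
  shows "cumulant k q b \<le> cumulant k q a"
  unfolding cumulant_def
proof (rule suminf_le)
  show "real N ^ q * log_coeff k N * exp (- (b * real N)) \<le> real N ^ q * log_coeff k N * exp (- (a * real N))" for N
    using mult_right_mono[OF assms(2), of "real N"] log_coeff_nonneg[of k N]
    by (intro mult_left_mono) auto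
  show "summable (\<lambda>N. real N ^ q * log_coeff k N * exp (- (b * real N)))"
    and "summable (\<lambda>N. real N ^ q * log_coeff k N * exp (- (a * real N)))"
    by (rule summable_log_coeff, use assms in linarith)+
qed

lemma isCont_cumulant:
  assumes "\<eta> > 0"
  shows "isCont (cumulant k q) \<eta>"
proof -
  have eq: "exp (- (c * real N)) = exp (- c) ^ N" for c N
    by (simp add: mult.commute flip: exp_of_nat_mult)
  have "summable (\<lambda>N. real N ^ q * log_coeff k N * exp (- (\<eta> / 2)) ^ N)"
    using summable_log_coeff[of "\<eta> / 2" q k] assms by (simp only: eq half_gt_zero)
  then have "isCont (\<lambda>\<eta>. \<Sum>N. real N ^ q * log_coeff k N * exp (- \<eta>) ^ N) \<eta>"
    by (intro isCont_powser'[where K = "exp (- (\<eta> / 2))"] continuous_intros) (use assms in auto)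
  then show ?thesis by (simp add: cumulant_def[abs_def] eq)
qed

text \<open>With cutoff M = 3 n k, where \<eta> M = 1, the progression has 3 n terms, each at least
  1. The resulting bound 3 n / e exceeds n because e \<le> 3.\<close>

lemma cumulant_1_unbounded:
  assumes k: "k \<ge> 2" and n: "n \<ge> 1"
  shows "cumulant k 1 (1 / (3 * real n * real k)) \<ge> real n"
proof -
  let ?M = "k * (3 * n)"
  have "real n \<le> exp (- 1) * (3 * real n)"
    using mult_left_mono[OF exp_le, of "real n"] by (simp add: exp_minus field_simps)
  also have "\<dots> = exp (- 1) * (\<Sum>l<?M div k. 1)" using k by simp
  also have "\<dots> \<le> exp (- 1) * (\<Sum>l<?M div k. real (k * l + 1) ^ 1)"
    by (intro mult_left_mono sum_mono) auto
  also have "\<dots> \<le> exp (- 1) * (\<Sum>m | m \<in> {1..?M} \<and> \<not> k dvd m. real m ^ 1)"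
    using k by (intro mult_left_mono sum_progression_le) auto
  also have "\<dots> \<le> cumulant k 1 (1 / (3 * real n * real k))"
    unfolding cumulant_def using k n by (intro weighted_suminf_ge summable_log_coeff) (auto simp: field_simps)
  finally show ?thesis .
qed

text \<open>Solutions come from the intermediate value theorem on [1/(3 n k), 1]. They tend to 0
  because \<eta>(n) \<ge> e would bound n, the first cumulant at \<eta>(n), by its value at
  e.\<close>

lemma saddle_points:
  assumes k: "k \<ge> 2"
  obtains \<eta> where "\<forall>\<^sub>F n in sequentially. \<eta> n > 0 \<and> cumulant k 1 (\<eta> n) = real n" "\<eta> \<longlonglongrightarrow> 0"
proof -
  \<comment> \<open>Where no solution has been established the chosen value is unspecified, hence
    the eventual form of the statement.\<close>
  define \<eta> where "\<eta> n = (SOME x. x > 0 \<and> cumulant k 1 x = real n)" for n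
  have "\<exists>x>0. cumulant k 1 x = real n" if n: "n \<ge> 1" "real n \<ge> cumulant k 1 1" for n
  proof -
    have a: "1 / (3 * real n * real k) > 0" "1 / (3 * real n * real k) \<le> 1"
      using k n mult_mono[of 1 "real n" 1 "real k"] by (auto simp: field_simps)
    have "\<exists>x\<ge>1 / (3 * real n * real k). x \<le> 1 \<and> cumulant k 1 x = real n"
    proof (rule IVT2)
      show "\<forall>x. 1 / (3 * real n * real k) \<le> x \<and> x \<le> 1 \<longrightarrow> isCont (cumulant k 1) x"
        using a(1) by (meson isCont_cumulant less_le_trans)
    qed (use a n k cumulant_1_unbounded in auto)
    then show ?thesis using a(1) by (meson less_le_trans)
  qed
  then have \<eta>: "\<eta> n > 0 \<and> cumulant k 1 (\<eta> n) = real n" if "n \<ge> 1" "real n \<ge> cumulant k 1 1" for n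
    unfolding \<eta>_def using that by (intro someI_ex[of "\<lambda>x. x > 0 \<and> cumulant k 1 x = real n"]) blast
  have ev: "\<forall>\<^sub>F n in sequentially. \<eta> n > 0 \<and> cumulant k 1 (\<eta> n) = real n"
    using eventually_ge_at_top[of 1] eventually_ge_at_top[of "nat \<lceil>cumulant k 1 1\<rceil>"]
    by eventually_elim (use \<eta> in \<open>auto simp: nat_le_iff ceiling_le_iff\<close>)
  have "\<eta> \<longlonglongrightarrow> 0"
  proof (rule order_tendstoI)
    fix e :: real assume e: "0 < e"
    have "\<forall>\<^sub>F n in sequentially. real n > cumulant k 1 e"
      using filterlim_real_sequentially unfolding filterlim_at_top_dense by blast
    with ev show "\<forall>\<^sub>F n in sequentially. \<eta> n < e"
    proof eventually_elim
      case (elim n)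
      then show ?case using cumulant_antimono[OF e, of "\<eta> n" k 1] by (cases "\<eta> n < e") auto
    qed
  next
    fix e :: real assume "e < 0"
    then show "\<forall>\<^sub>F n in sequentially. e < \<eta> n"
      using ev by (auto elim: eventually_mono)
  qed
  with ev show ?thesis by (rule that)
qed

section \<open>The characteristic function\<close>

text \<open>
  The logarithm of the characteristic function; the random integer is compound Poisson with Levy
  weights \<open>log_coeff k N * exp (- \<eta> N)\<close>.
\<close>

definition char_exponent :: "nat \<Rightarrow> real \<Rightarrow> real \<Rightarrow> complex" where
  "char_exponent k \<eta> y = (\<Sum>N. of_real (log_coeff k N * exp (- (\<eta> * real N))) * (cis (real N * y) - 1))"

lemma summable_char:
  assumes "\<eta> > 0"
  shows "summable (\<lambda>N. norm (complex_of_real (log_coeff k N * exp (- (\<eta> * real N))) * cis (real N * y)))"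
  using summable_log_coeff[OF assms, of 0 k] log_coeff_nonneg by (simp add: norm_mult abs_mult)

lemma cumulant_sums:
  assumes "\<eta> > 0"
  shows "(\<lambda>N. complex_of_real (real N ^ q * log_coeff k N * exp (- (\<eta> * real N)))) sums of_real (cumulant k q \<eta>)"
  unfolding sums_of_real_iff cumulant_def by (rule summable_sums summable_log_coeff assms)+

lemma gen_fun_eq:
  assumes "\<eta> > 0"
  shows "gen_fun k (of_real (exp (- \<eta>)) * cis y) = of_real (exp (cumulant k 0 \<eta>)) * exp (char_exponent k \<eta> y)"
proof -
  let ?f = "\<lambda>N. complex_of_real (log_coeff k N * exp (- (\<eta> * real N)))"
  have "(\<lambda>N. ?f N * cis (real N * y)) sums (\<Sum>N. ?f N * cis (real N * y))"
    using summable_norm_cancel[OF summable_char[OF assms]] by (rule summable_sums)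
  from sums_diff[OF this cumulant_sums[OF assms, of 0 k]]
  have "char_exponent k \<eta> y = (\<Sum>N. ?f N * cis (real N * y)) - of_real (cumulant k 0 \<eta>)"
    unfolding char_exponent_def by (simp add: sums_iff right_diff_distrib)
  moreover have "(\<Sum>N. of_real (log_coeff k N) * (of_real (exp (- \<eta>)) * cis y) ^ N) = (\<Sum>N. ?f N * cis (real N * y))"
    by (intro suminf_cong)
      (simp add: power_mult_distrib Complex.DeMoivre mult_ac flip: of_real_power exp_of_nat_mult)
  ultimately show ?thesis
    by (simp add: gen_fun_def exp_diff exp_of_real)
qed

text \<open>The Taylor bound |N y|^3 / 6 for each cis(N y) is summed against the Levy weights; the
  coefficients of degree 1 and 2 sum to the cumulants.\<close>

lemma char_exponent_taylor:
  assumes "\<eta> > 0"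
  shows "norm (char_exponent k \<eta> y - \<i> * of_real (cumulant k 1 \<eta> * y) + of_real (cumulant k 2 \<eta> * y\<^sup>2 / 2))
    \<le> cumulant k 3 \<eta> * \<bar>y\<bar> ^ 3 / 6"
proof -
  let ?f = "\<lambda>N. complex_of_real (log_coeff k N * exp (- (\<eta> * real N)))"
  have "(\<lambda>N. ?f N * cis (real N * y)) sums (\<Sum>N. ?f N * cis (real N * y))"
    using summable_norm_cancel[OF summable_char[OF assms]] by (rule summable_sums)
  from sums_diff[OF this cumulant_sums[OF assms, of 0 k]]
  have s0: "(\<lambda>N. ?f N * (cis (real N * y) - 1)) sums char_exponent k \<eta> y"
    unfolding char_exponent_def by (simp add: sums_iff right_diff_distrib)
  have s: "(\<lambda>N. ?f N * (cis (real N * y) - (\<Sum>j\<le>2. (\<i> * of_real (real N * y)) ^ j / fact j)))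
    sums (char_exponent k \<eta> y - \<i> * of_real (cumulant k 1 \<eta> * y) + of_real (cumulant k 2 \<eta> * y\<^sup>2 / 2))"
    using sums_add[OF sums_diff[OF s0 sums_mult[OF cumulant_sums[OF assms, of 1 k], of "\<i> * of_real y"]]
      sums_mult[OF cumulant_sums[OF assms, of 2 k], of "of_real (y\<^sup>2 / 2)"]]
    by (simp add: numeral_2_eq_2 power_mult_distrib algebra_simps)
  have bound: "norm (?f N * (cis (real N * y) - (\<Sum>j\<le>2. (\<i> * of_real (real N * y)) ^ j / fact j)))
      \<le> real N ^ 3 * log_coeff k N * exp (- (\<eta> * real N)) * (\<bar>y\<bar> ^ 3 / 6)" for N
  proof -
    have "norm (cis (real N * y) - (\<Sum>j\<le>2. (\<i> * of_real (real N * y)) ^ j / fact j)) \<le> \<bar>real N * y\<bar> ^ 3 / 6"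
      using iexp_approx1[of "real N * y" 2] by (simp add: cis_conv_exp fact_numeral eval_nat_numeral)
    then have "norm (?f N) * norm (cis (real N * y) - (\<Sum>j\<le>2. (\<i> * of_real (real N * y)) ^ j / fact j))
        \<le> norm (?f N) * (\<bar>real N * y\<bar> ^ 3 / 6)"
      by (rule mult_left_mono) simp
    also have "\<dots> = real N ^ 3 * log_coeff k N * exp (- (\<eta> * real N)) * (\<bar>y\<bar> ^ 3 / 6)"
      using log_coeff_nonneg[of k N] by (simp add: norm_mult abs_mult power_mult_distrib)
    finally show ?thesis by (simp only: norm_mult)
  qed
  have s3: "(\<lambda>N. real N ^ 3 * log_coeff k N * exp (- (\<eta> * real N)) * (\<bar>y\<bar> ^ 3 / 6)) sums (cumulant k 3 \<eta> * (\<bar>y\<bar> ^ 3 / 6))"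
    unfolding cumulant_def by (intro sums_mult2 summable_sums summable_log_coeff assms)
  have "norm (\<Sum>N. ?f N * (cis (real N * y) - (\<Sum>j\<le>2. (\<i> * of_real (real N * y)) ^ j / fact j)))
      \<le> (\<Sum>N. real N ^ 3 * log_coeff k N * exp (- (\<eta> * real N)) * (\<bar>y\<bar> ^ 3 / 6))"
    by (rule norm_suminf_le[OF bound sums_summable[OF s3]])
  then show ?thesis
    using s s3 by (simp add: sums_iff)
qed

text \<open>The modulus of an exponential depends on the real part, a weighted sum of cos(N y) - 1 =
  - |1 - cis(N y)|^2 / 2. The last factor 1/2 doubles 3145728 to 6291456.\<close>

lemma char_decay_aux:
  assumes k: "k \<ge> 2" and \<eta>: "\<eta> > 0" and M: "\<eta> * real M \<le> 1" "M \<ge> 64 * k"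
  shows "norm (exp (char_exponent k \<eta> y))
    \<le> exp (- (exp (- 1) / (6291456 * real k ^ 6) * min (real M) (real M ^ 3 * (norm (1 - cis y))\<^sup>2)))"
proof -
  let ?g = "\<lambda>m. (norm (1 - cis y ^ m))\<^sup>2 / 2"
  have g: "?g m = 1 - cos (real m * y)" for m
    by (subst norm_one_minus_squared) (simp_all add: norm_power Complex.DeMoivre)
  have smc: "summable (\<lambda>N. log_coeff k N * exp (- (\<eta> * real N)))"
    using summable_log_coeff[OF \<eta>, of 0 k] by simp
  have sm: "summable (\<lambda>N. ?g N * log_coeff k N * exp (- (\<eta> * real N)))"
  proof (rule summable_comparison_test')
    show "summable (\<lambda>N. 2 * (log_coeff k N * exp (- (\<eta> * real N))))"
      using smc by (rule summable_mult)
    show "norm (?g N * log_coeff k N * exp (- (\<eta> * real N))) \<le> 2 * (log_coeff k N * exp (- (\<eta> * real N)))" for N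
      using log_coeff_nonneg[of k N] cos_ge_minus_one[of "real N * y"] mult_right_mono[of "?g N" 2 "log_coeff k N * exp (- (\<eta> * real N))"]
      unfolding g by (simp add: abs_mult)
  qed
  have "summable (\<lambda>N. complex_of_real (log_coeff k N * exp (- (\<eta> * real N))) * (cis (real N * y) - 1))"
    using summable_diff[OF summable_norm_cancel[OF summable_char[OF \<eta>, of k y]] sums_summable[OF cumulant_sums[OF \<eta>, of 0 k]]]
    by (simp add: right_diff_distrib)
  then have "Re (char_exponent k \<eta> y) = (\<Sum>N. log_coeff k N * exp (- (\<eta> * real N)) * (cos (real N * y) - 1))"
    unfolding char_exponent_def by (subst Re_suminf) auto
  also have "\<dots> = (\<Sum>N. - (?g N * log_coeff k N * exp (- (\<eta> * real N))))"
    unfolding g by (intro suminf_cong) (simp add: algebra_simps)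
  also have "\<dots> = - (\<Sum>N. ?g N * log_coeff k N * exp (- (\<eta> * real N)))"
    using sm by (rule suminf_minus)
  also have "\<dots> \<le> - (exp (- 1) * (\<Sum>m | m \<in> {1..M} \<and> \<not> k dvd m. ?g m))"
    using weighted_suminf_ge[OF \<eta> M(1) _ sm] by simp
  also have "(\<Sum>m | m \<in> {1..M} \<and> \<not> k dvd m. ?g m) = (\<Sum>m | m \<in> {1..M} \<and> \<not> k dvd m. (norm (1 - cis y ^ m))\<^sup>2) / 2"
    by (simp add: sum_divide_distrib)
  also have "- (exp (- 1) * \<dots>) \<le> - (exp (- 1) * (min (real M) (real M ^ 3 * (norm (1 - cis y))\<^sup>2) / (3145728 * real k ^ 6) / 2))"
    by (intro le_imp_neg_le mult_left_mono divide_right_mono regular_character_sum_ge k M(2)) auto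
  also have "\<dots> = - (exp (- 1) / (6291456 * real k ^ 6) * min (real M) (real M ^ 3 * (norm (1 - cis y))\<^sup>2))"
    by simp
  finally show ?thesis by (simp add: norm_exp_eq_Re)
qed

text \<open>The left side is 2 sin(|y|/2). On [0, \<pi>/2] one has x < 1.6, so x^2 \<le> 3, and then
  sin x \<ge> x - x^3/6 \<ge> x/2.\<close>

lemma norm_one_minus_cis_ge:
  assumes "\<bar>y\<bar> \<le> pi"
  shows "norm (1 - cis y) \<ge> \<bar>y\<bar> / 2"
proof -
  have sin_ge: "sin x \<ge> x / 2" if x: "0 \<le> x" "x \<le> pi / 2" for x :: real
  proof -
    have "\<bar>sin x - x\<bar> \<le> x ^ 3 / 6"
      using Maclaurin_sin_bound[of x 3] x(1)
      by (simp add: eval_nat_numeral sin_coeff_def)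
    moreover have "x \<le> 1.6" using x(2) pi_approx by simp
    then have "x * x \<le> 1.6 * 1.6" using x(1) by (intro mult_mono) auto
    then have "x * (x * x) \<le> x * 3" using x(1) by (intro mult_left_mono) auto
    then have "x ^ 3 / 6 \<le> x / 2" by (simp add: power3_eq_cube)
    ultimately show ?thesis by linarith
  qed
  have "(norm (1 - cis y))\<^sup>2 = 2 - 2 * cos (2 * (\<bar>y\<bar> / 2))"
    by (subst norm_one_minus_squared) simp_all
  also have "\<dots> = (2 * sin (\<bar>y\<bar> / 2))\<^sup>2"
    by (subst cos_double_sin) (simp add: power2_eq_square)
  finally have "(norm (1 - cis y))\<^sup>2 = (2 * sin (\<bar>y\<bar> / 2))\<^sup>2" .
  moreover have "\<bar>y\<bar> / 2 \<le> 2 * sin (\<bar>y\<bar> / 2)"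
    using sin_ge[of "\<bar>y\<bar> / 2"] assms by simp
  ultimately show ?thesis
    by (smt (verit) norm_ge_zero power2_le_imp_le power_mono zero_le_divide_iff)
qed

lemma norm_one_minus_cis_le: "norm (1 - cis y) \<le> \<bar>y\<bar>"
  using iexp_approx1[of y 0] by (simp add: cis_conv_exp norm_minus_commute)

context
  fixes k :: nat and \<eta> :: real
  assumes k: "k \<ge> 2" and \<eta>: "0 < \<eta>" "\<eta> * (128 * real k) \<le> 1"
begin

text \<open>The floor of 1/\<eta> works: the assumption with 128 = 2 * 64 gives 1/(2 \<eta>) \<ge>
  64 k \<ge> 1, so rounding down loses at most half.\<close>

lemma ex_cutoff: "\<exists>M. \<eta> * real M \<le> 1 \<and> M \<ge> 64 * k \<and> real M \<ge> 1 / (2 * \<eta>)"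
proof (intro exI conjI)
  let ?M = "nat \<lfloor>1 / \<eta>\<rfloor>"
  have "1 / \<eta> > 0" using \<eta> by simp
  then have M: "real ?M \<le> 1 / \<eta>" "real ?M > 1 / \<eta> - 1" by linarith+
  have "\<eta> * real ?M \<le> \<eta> * (1 / \<eta>)" using M(1) \<eta> by (intro mult_left_mono) auto
  then show "\<eta> * real ?M \<le> 1" using \<eta> by simp
  have "128 * real k \<le> 1 / \<eta>" using \<eta> by (simp add: field_simps)
  then have *: "64 * real k \<le> 1 / (2 * \<eta>)" by simp
  then have "1 \<le> 1 / (2 * \<eta>)" using k by linarith
  then show **: "real ?M \<ge> 1 / (2 * \<eta>)" using M(2) by simp
  with * have "64 * real k \<le> real ?M" by linarith
  then show "?M \<ge> 64 * k" by linarith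
qed

lemma cumulant_2_lower: "cumulant k 2 \<eta> \<ge> exp (- 1) / (192 * real k ^ 3) / \<eta> ^ 3"
proof -
  obtain M where M: "\<eta> * real M \<le> 1" "M \<ge> 64 * k" "real M \<ge> 1 / (2 * \<eta>)"
    using ex_cutoff by blast
  have "exp (- 1) / (192 * real k ^ 3) / \<eta> ^ 3 = exp (- 1) * (1 / (2 * \<eta>)) ^ 3 / (24 * real k ^ 3)"
    by (simp add: power_divide power_mult_distrib)
  also have "\<dots> \<le> exp (- 1) * real M ^ 3 / (24 * real k ^ 3)"
    using M(3) \<eta> by (intro divide_right_mono mult_left_mono power_mono) auto
  also have "\<dots> \<le> cumulant k 2 \<eta>"
    using k \<eta> M by (intro cumulant_2_ge) auto
  finally show ?thesis .
qed

lemma cumulant_2_pos: "cumulant k 2 \<eta> > 0"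
proof -
  have "exp (- 1) / (192 * real k ^ 3) / \<eta> ^ 3 > 0" using k \<eta> by simp
  with cumulant_2_lower show ?thesis by linarith
qed

lemma cumulant_2_upper: "cumulant k 2 \<eta> \<le> 32 / \<eta> ^ 3"
  using cumulant_le[OF \<eta>(1), of k 1] by (simp add: power_divide eval_nat_numeral)

lemma cumulant_3_upper: "cumulant k 3 \<eta> \<le> 192 / \<eta> ^ 4"
  using cumulant_le[OF \<eta>(1), of k 2] by (simp add: power_divide eval_nat_numeral)

lemma cumulant_3_nonneg: "cumulant k 3 \<eta> \<ge> 0"
  unfolding cumulant_def using log_coeff_nonneg
  by (intro suminf_nonneg summable_log_coeff \<eta>) auto

text \<open>The orders are \<eta>^(-8) for the squared third cumulant and \<eta>^9 for the inverse
  cube of the variance. Squaring removes the square root in the standard deviation.\<close>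

lemma skewness_le:
  "(cumulant k 3 \<eta> * (1 / sqrt (cumulant k 2 \<eta>)) ^ 3)\<^sup>2 \<le> 192\<^sup>2 * (192 * real k ^ 3 * exp 1) ^ 3 * \<eta>"
proof -
  let ?V = "cumulant k 2 \<eta>"
  have "(cumulant k 3 \<eta> * (1 / sqrt ?V) ^ 3)\<^sup>2 = (cumulant k 3 \<eta>)\<^sup>2 * ((1 / sqrt ?V)\<^sup>2) ^ 3"
    by (simp add: power_mult_distrib flip: power_mult)
  also have "(1 / sqrt ?V)\<^sup>2 = 1 / ?V"
    using cumulant_2_pos by (simp add: power_divide)
  also have "(cumulant k 3 \<eta>)\<^sup>2 * (1 / ?V) ^ 3 \<le> (192 / \<eta> ^ 4)\<^sup>2 * (1 / (exp (- 1) / (192 * real k ^ 3) / \<eta> ^ 3)) ^ 3"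
    using k \<eta> cumulant_2_pos
    by (intro mult_mono power_mono divide_left_mono cumulant_2_lower cumulant_3_upper cumulant_3_nonneg) auto
  also have "\<dots> = 192\<^sup>2 * (192 * real k ^ 3 * exp 1) ^ 3 * \<eta>"
    using \<eta> by (simp add: exp_minus field_simps eval_nat_numeral)
  finally show ?thesis .
qed

text \<open>The witness is X = 1/(2 \<eta>). From |\<sigma> t| \<le> \<pi> and the variance bound,
  t^2 \<le> 10 * 32 / \<eta>^3 = 2560 X^3. The inequality \<sigma>^2 \<ge> \<eta>^3/32 would give
  t^2/1024 in the minimum; 4096 is a convenient weakening. Hiding \<eta> behind X prepares a bound
  that depends on t alone.\<close>

lemma char_decay:
  defines "\<sigma> \<equiv> 1 / sqrt (cumulant k 2 \<eta>)"
  assumes t: "\<bar>\<sigma> * t\<bar> \<le> pi"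
  shows "\<exists>X\<ge>0. t\<^sup>2 \<le> 2560 * X ^ 3 \<and>
    norm (exp (char_exponent k \<eta> (\<sigma> * t))) \<le> exp (- (exp (- 1) / (6291456 * real k ^ 6) * min X (t\<^sup>2 / 4096)))"
proof (intro exI conjI)
  let ?V = "cumulant k 2 \<eta>" and ?X = "1 / (2 * \<eta>)"
  show "?X \<ge> 0" using \<eta> by simp
  have \<sigma>2: "\<sigma>\<^sup>2 = 1 / ?V" using cumulant_2_pos by (simp add: \<sigma>_def power_divide)
  have "(\<sigma> * t)\<^sup>2 \<le> pi\<^sup>2" using t by (simp add: abs_le_square_iff[symmetric])
  also have "pi\<^sup>2 \<le> 3.15 * 3.15" unfolding power2_eq_square using pi_approx by (intro mult_mono) auto
  finally have "t\<^sup>2 \<le> 10 * ?V"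
    using cumulant_2_pos by (simp add: power_mult_distrib \<sigma>2 field_simps)
  also have "\<dots> \<le> 10 * (32 / \<eta> ^ 3)" using cumulant_2_upper by simp
  finally show "t\<^sup>2 \<le> 2560 * ?X ^ 3" by (simp add: power_divide power_mult_distrib)
  obtain M where M: "\<eta> * real M \<le> 1" "M \<ge> 64 * k" "real M \<ge> ?X"
    using ex_cutoff by blast
  have "t\<^sup>2 / 4096 = (1 / (2 * \<eta>)) ^ 3 * (t\<^sup>2 * (\<eta> ^ 3 / 32) / 16)"
    using \<eta> by (simp add: field_simps eval_nat_numeral)
  also have "\<dots> \<le> (1 / (2 * \<eta>)) ^ 3 * ((\<bar>\<sigma> * t\<bar> / 2)\<^sup>2)"
  proof (intro mult_left_mono)
    have "\<eta> ^ 3 / 32 \<le> 1 / ?V" using cumulant_2_upper cumulant_2_pos \<eta> by (simp add: field_simps)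
    then have "t\<^sup>2 * (\<eta> ^ 3 / 32) \<le> t\<^sup>2 * (1 / ?V)" by (intro mult_left_mono) auto
    moreover have "t\<^sup>2 * (1 / ?V) \<ge> 0" using cumulant_2_pos by simp
    moreover have "a / 16 \<le> b / 4" if "a \<le> b" "b \<ge> 0" for a b :: real using that by linarith
    ultimately have "t\<^sup>2 * (\<eta> ^ 3 / 32) / 16 \<le> t\<^sup>2 * (1 / ?V) / 4" by blast
    then show "t\<^sup>2 * (\<eta> ^ 3 / 32) / 16 \<le> (\<bar>\<sigma> * t\<bar> / 2)\<^sup>2"
      using cumulant_2_pos by (simp add: power_divide power_mult_distrib \<sigma>2)
  qed (use \<eta> in auto)
  also have "\<dots> \<le> real M ^ 3 * (norm (1 - cis (\<sigma> * t)))\<^sup>2"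
    using M(3) \<eta> norm_one_minus_cis_ge[OF t] by (intro mult_mono power_mono) auto
  finally have "min ?X (t\<^sup>2 / 4096) \<le> min (real M) (real M ^ 3 * (norm (1 - cis (\<sigma> * t)))\<^sup>2)"
    using M(3) by auto
  then have "exp (- 1) / (6291456 * real k ^ 6) * min ?X (t\<^sup>2 / 4096)
      \<le> exp (- 1) / (6291456 * real k ^ 6) * min (real M) (real M ^ 3 * (norm (1 - cis (\<sigma> * t)))\<^sup>2)"
    by (intro mult_left_mono) auto
  then show "norm (exp (char_exponent k \<eta> (\<sigma> * t))) \<le> exp (- (exp (- 1) / (6291456 * real k ^ 6) * min ?X (t\<^sup>2 / 4096)))"
    using char_decay_aux[OF k \<eta>(1) M(1,2), of "\<sigma> * t"] by (meson exp_le_cancel_iff neg_le_iff_le order_trans)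
qed

end

lemma one_plus_power_exp_le:
  fixes c s :: real
  assumes "c > 0" "s \<ge> 0"
  shows "(1 + s) ^ q * exp (- (c * s)) \<le> exp c * fact q / c ^ q"
proof -
  have "(1 + s) ^ q * exp (- (c * s)) = exp c * ((1 + s) ^ q * exp (- (c * (1 + s))))"
    by (simp add: algebra_simps flip: exp_add)
  also have "\<dots> \<le> exp c * (fact q / c ^ q)"
    using assms by (intro mult_left_mono power_exp_minus_le) auto
  finally show ?thesis by simp
qed

text \<open>If X is the minimum, the constraint makes 1 + t^2 at most 2560 (1 + X)^3, a polynomial
  in X that exp(-c X) absorbs; otherwise the decay is Gaussian in t. Since C does not depend on X,
  the domination is uniform.\<close>

lemma min_decay_bound:
  fixes c :: real
  assumes c: "c > 0"
  shows "\<exists>C. \<forall>X\<ge>0. \<forall>t. t\<^sup>2 \<le> 2560 * X ^ 3 \<longrightarrow> (1 + t\<^sup>2) ^ q * exp (- (c * min X (t\<^sup>2 / 4096))) \<le> C"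
proof (intro exI allI impI)
  let ?C1 = "4096 ^ q * (exp c * fact q / c ^ q)" and ?C2 = "2560 ^ q * (exp c * fact (3 * q) / c ^ (3 * q))"
  fix X t :: real assume X: "X \<ge> 0" "t\<^sup>2 \<le> 2560 * X ^ 3"
  have pos: "?C1 \<ge> 0" "?C2 \<ge> 0" using c by simp_all
  show "(1 + t\<^sup>2) ^ q * exp (- (c * min X (t\<^sup>2 / 4096))) \<le> ?C1 + ?C2"
  proof (cases "X \<le> t\<^sup>2 / 4096")
    case True
    have "1 + t\<^sup>2 \<le> 1 + 2560 * X ^ 3" using X by simp
    also have "\<dots> \<le> 2560 * (1 + X) ^ 3"
      using X(1) by (simp add: power3_eq_cube algebra_simps)
    finally have "(1 + t\<^sup>2) ^ q \<le> (2560 * (1 + X) ^ 3) ^ q" by (intro power_mono) auto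
    then have "(1 + t\<^sup>2) ^ q * exp (- (c * X)) \<le> (2560 * (1 + X) ^ 3) ^ q * exp (- (c * X))"
      by (rule mult_right_mono) simp
    also have "\<dots> = 2560 ^ q * ((1 + X) ^ (3 * q) * exp (- (c * X)))"
      by (simp add: power_mult_distrib power_mult)
    also have "\<dots> \<le> ?C2"
      using c X by (intro mult_left_mono one_plus_power_exp_le) auto
    finally show ?thesis using True pos by simp
  next
    case False
    have "(1 + t\<^sup>2) ^ q \<le> (4096 * (1 + t\<^sup>2 / 4096)) ^ q" by (intro power_mono) auto
    then have "(1 + t\<^sup>2) ^ q * exp (- (c * (t\<^sup>2 / 4096))) \<le> (4096 * (1 + t\<^sup>2 / 4096)) ^ q * exp (- (c * (t\<^sup>2 / 4096)))"
      by (rule mult_right_mono) simp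
    also have "\<dots> = 4096 ^ q * ((1 + t\<^sup>2 / 4096) ^ q * exp (- (c * (t\<^sup>2 / 4096))))"
      by (simp only: power_mult_distrib mult.assoc)
    also have "\<dots> \<le> ?C1"
      using c by (intro mult_left_mono one_plus_power_exp_le) auto
    finally show ?thesis using False pos by (simp add: min_def)
  qed
qed

section \<open>The limit of the rescaled Jensen polynomials\<close>

lemma gaussian_moment_Suc_Suc:
  "(\<integral>t. std_normal_density t * t ^ Suc (Suc j) \<partial>lborel) = (real j + 1) * (\<integral>t. std_normal_density t * t ^ j \<partial>lborel)"
proof (cases "even j")
  case True
  then obtain m where m: "j = 2 * m" by blast
  have "(\<integral>t. std_normal_density t * t ^ Suc (Suc j) \<partial>lborel) = fact (2 * Suc m) / (2 ^ Suc m * fact (Suc m))"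
    using integral_std_normal_moment_even[of "Suc m"] by (simp add: m)
  also have "\<dots> = (2 * (real m + 1) * ((2 * real m + 1) * fact (2 * m))) / (2 * (real m + 1) * (2 ^ m * fact m))"
    by (simp add: algebra_simps)
  also have "\<dots> = ((2 * real m + 1) * fact (2 * m)) / (2 ^ m * fact m)"
    by (rule mult_divide_mult_cancel_left) simp
  also have "\<dots> = (real j + 1) * (fact (2 * m) / (2 ^ m * fact m))"
    by (simp add: m)
  finally show ?thesis by (simp only: m integral_std_normal_moment_even)
next
  case False
  then obtain m where m: "j = 2 * m + 1" by (blast elim: oddE)
  show ?thesis
    using integral_std_normal_moment_odd[of "Suc m"] integral_std_normal_moment_odd[of m] by (simp add: m)
qed

text \<open>The normal moments satisfy the same recurrence up to sign, and the sign is supplied by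
  the square of the imaginary unit.\<close>

lemma hermite_const_moment:
  "complex_of_real (hermite_const j) = \<i> ^ j * of_real (\<integral>t. std_normal_density t * t ^ j \<partial>lborel)"
proof (induction j rule: hermite_const.induct)
  case 1
  then show ?case using integral_std_normal_moment_even[of 0] by simp
next
  case 2
  then show ?case using integral_std_normal_moment_odd[of 0] by simp
next
  case (3 j)
  then show ?case unfolding gaussian_moment_Suc_Suc by (simp add: algebra_simps)
qed

lemma gaussian_integral_hermite:
  "(\<integral>t. of_real (exp (- t\<^sup>2 / 2)) * (of_real x + \<i> * of_real t) ^ d \<partial>lborel) = complex_of_real (sqrt (2 * pi) * hermite d x)"
proof -
  let ?m = "\<lambda>j t. std_normal_density t * t ^ j"
  have "of_real (exp (- t\<^sup>2 / 2)) * (of_real x + \<i> * of_real t) ^ d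
      = (\<Sum>j\<le>d. (of_real (sqrt (2 * pi)) * of_nat (d choose j) * \<i> ^ j * of_real (x ^ (d - j))) * complex_of_real (?m j t))" for t
  proof -
    have "exp (- t\<^sup>2 / 2) = sqrt (2 * pi) * std_normal_density t"
      by (simp add: std_normal_density_def)
    then show ?thesis
      by (subst add.commute, subst binomial_ring) (simp add: sum_distrib_left power_mult_distrib mult_ac)
  qed
  then have "(\<integral>t. of_real (exp (- t\<^sup>2 / 2)) * (of_real x + \<i> * of_real t) ^ d \<partial>lborel)
      = (\<integral>t. (\<Sum>j\<le>d. (of_real (sqrt (2 * pi)) * of_nat (d choose j) * \<i> ^ j * of_real (x ^ (d - j))) * complex_of_real (?m j t)) \<partial>lborel)"
    by (simp only:)
  also have "\<dots> = (\<Sum>j\<le>d. (\<integral>t. (of_real (sqrt (2 * pi)) * of_nat (d choose j) * \<i> ^ j * of_real (x ^ (d - j))) * complex_of_real (?m j t) \<partial>lborel))"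
    by (intro Bochner_Integration.integral_sum integrable_mult_right integrable_of_real integrable_std_normal_moment)
  also have "\<dots> = (\<Sum>j\<le>d. (of_real (sqrt (2 * pi)) * of_nat (d choose j) * \<i> ^ j * of_real (x ^ (d - j))) * of_real (\<integral>t. ?m j t \<partial>lborel))"
    by (simp only: integral_mult_right_zero integral_complex_of_real)
  also have "\<dots> = (\<Sum>j\<le>d. of_real (sqrt (2 * pi)) * of_nat (d choose j) * of_real (x ^ (d - j)) * of_real (hermite_const j))"
    by (intro sum.cong refl) (simp add: hermite_const_moment mult_ac)
  also have "\<dots> = complex_of_real (sqrt (2 * pi) * hermite d x)"
    by (simp add: hermite_def sum_distrib_left mult_ac)
  finally show ?thesis .
qed

lemma integrable_inverse_one_plus_square: "integrable lborel (\<lambda>t::real. inverse (1 + t\<^sup>2))"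
proof -
  have "einterval (-\<infinity>) \<infinity> = UNIV" by (auto simp: einterval_def)
  then show ?thesis
    using integrable_inverse_1_plus_square by (simp add: set_integrable_def)
qed

lemma cis_linear_approx: "norm (cis y - 1 - \<i> * of_real y) \<le> y\<^sup>2 / 2"
  using iexp_approx1[of y 1] by (simp add: cis_conv_exp diff_diff_eq numeral_2_eq_2)

text \<open>The numerator is (1 - cis(-\<sigma> t)) + \<sigma> x cis(-\<sigma> t), so the quotient
  is at most |t| + |x|, uniformly in \<sigma>. The weaker form with 1 + t^2 makes its d-th power
  cancel against the decay estimate.\<close>

lemma rescaled_factor_le:
  assumes "\<sigma> > 0"
  shows "norm ((1 - (1 - of_real (\<sigma> * x)) * cis (- (\<sigma> * t))) / of_real \<sigma>) \<le> 2 * (1 + \<bar>x\<bar>) * (1 + t\<^sup>2)"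
proof -
  have "(1 - (1 - of_real (\<sigma> * x)) * cis (- (\<sigma> * t))) / of_real \<sigma>
      = (1 - cis (- (\<sigma> * t))) / of_real \<sigma> + of_real x * cis (- (\<sigma> * t))"
    using assms by (simp add: field_simps)
  also have "norm \<dots> \<le> norm ((1 - cis (- (\<sigma> * t))) / of_real \<sigma>) + norm (of_real x * cis (- (\<sigma> * t)))"
    by (rule norm_triangle_ineq)
  also have "\<dots> \<le> \<bar>t\<bar> + \<bar>x\<bar>"
    using norm_one_minus_cis_le[of "- (\<sigma> * t)"] assms
    by (intro add_mono) (simp_all add: norm_divide norm_mult abs_mult field_simps)
  also have "\<dots> \<le> 2 * (1 + \<bar>x\<bar>) * (1 + t\<^sup>2)"
  proof -
    have "0 \<le> (\<bar>t\<bar> - 1)\<^sup>2" by simp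
    then have "2 * \<bar>t\<bar> \<le> 1 + t\<^sup>2" by (simp add: power2_eq_square algebra_simps)
    moreover have "0 \<le> \<bar>x\<bar> * t\<^sup>2" by simp
    moreover have "2 * (1 + \<bar>x\<bar>) * (1 + t\<^sup>2) = 2 + 2 * \<bar>x\<bar> + 2 * t\<^sup>2 + 2 * (\<bar>x\<bar> * t\<^sup>2)"
      by (simp add: algebra_simps)
    ultimately show ?thesis by (smt (verit) zero_le_power2)
  qed
  finally show ?thesis .
qed

lemma rescaled_factor_tendsto:
  assumes \<sigma>: "\<And>i. \<sigma> i > 0" "\<sigma> \<longlonglongrightarrow> 0"
  shows "(\<lambda>i. (1 - (1 - of_real (\<sigma> i * x)) * cis (- (\<sigma> i * t))) / of_real (\<sigma> i)) \<longlonglongrightarrow> of_real x + \<i> * of_real t"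
proof -
  have "(\<lambda>i. (1 - cis (- (\<sigma> i * t))) / of_real (\<sigma> i) - \<i> * of_real t) \<longlonglongrightarrow> 0"
  proof (rule Lim_null_comparison)
    show "\<forall>\<^sub>F i in sequentially. norm ((1 - cis (- (\<sigma> i * t))) / of_real (\<sigma> i) - \<i> * of_real t) \<le> \<sigma> i * t\<^sup>2 / 2"
    proof (rule always_eventually, rule allI)
      fix i
      have "(1 - cis (- (\<sigma> i * t))) / of_real (\<sigma> i) - \<i> * of_real t
          = - ((cis (- (\<sigma> i * t)) - 1 - \<i> * of_real (- (\<sigma> i * t))) / of_real (\<sigma> i))"
        using \<sigma>(1)[of i] by (simp add: field_simps)
      then have "norm ((1 - cis (- (\<sigma> i * t))) / of_real (\<sigma> i) - \<i> * of_real t)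
          = norm ((cis (- (\<sigma> i * t)) - 1 - \<i> * of_real (- (\<sigma> i * t))) / of_real (\<sigma> i))"
        by (simp only: norm_minus_cancel)
      also have "\<dots> = norm (cis (- (\<sigma> i * t)) - 1 - \<i> * of_real (- (\<sigma> i * t))) / \<sigma> i"
        using \<sigma>(1)[of i] by (simp only: norm_divide norm_of_real abs_of_pos)
      also have "\<dots> \<le> ((- (\<sigma> i * t))\<^sup>2 / 2) / \<sigma> i"
        using \<sigma>(1)[of i] by (intro divide_right_mono cis_linear_approx) simp
      also have "\<dots> = \<sigma> i * t\<^sup>2 / 2"
        using \<sigma>(1)[of i] by (simp add: field_simps power2_eq_square)
      finally show "norm ((1 - cis (- (\<sigma> i * t))) / of_real (\<sigma> i) - \<i> * of_real t) \<le> \<sigma> i * t\<^sup>2 / 2" .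
    qed
    show "(\<lambda>i. \<sigma> i * t\<^sup>2 / 2) \<longlonglongrightarrow> 0"
      using tendsto_mult_right[OF \<sigma>(2), of "t\<^sup>2 / 2"] by simp
  qed
  moreover have "(\<lambda>i. of_real x * cis (- (\<sigma> i * t))) \<longlonglongrightarrow> of_real x * cis (- (0 * t))"
    by (intro tendsto_intros \<sigma>)
  ultimately have "(\<lambda>i. ((1 - cis (- (\<sigma> i * t))) / of_real (\<sigma> i) - \<i> * of_real t) + \<i> * of_real t + of_real x * cis (- (\<sigma> i * t)))
      \<longlonglongrightarrow> 0 + \<i> * of_real t + of_real x * cis (- (0 * t))"
    by (intro tendsto_add tendsto_const)
  moreover have "((1 - cis (- (\<sigma> i * t))) / of_real (\<sigma> i) - \<i> * of_real t) + \<i> * of_real t + of_real x * cis (- (\<sigma> i * t))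
      = (1 - (1 - of_real (\<sigma> i * x)) * cis (- (\<sigma> i * t))) / of_real (\<sigma> i)" for i
    using \<sigma>(1)[of i] by (simp add: field_simps)
  ultimately show ?thesis by (simp add: add.commute)
qed

text \<open>Indexing by i allows a passage to a tail of the integers n, on which the conditions on
  \<eta> hold for every index and not just eventually.\<close>

context
  fixes k d :: nat and \<eta> :: "nat \<Rightarrow> real" and n :: "nat \<Rightarrow> nat" and x :: real
  assumes k: "k \<ge> 2"
    and \<eta>: "\<And>i. 0 < \<eta> i" "\<And>i. \<eta> i * (128 * real k) \<le> 1" "\<eta> \<longlonglongrightarrow> 0"
    and saddle: "\<And>i. cumulant k 1 (\<eta> i) = real (n i)"
begin

definition width :: "nat \<Rightarrow> real" where
  "width i = 1 / sqrt (cumulant k 2 (\<eta> i))"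

text \<open>One power of the width is absent here: it comes from the change of variable y =
  \<open>width i * t\<close>.\<close>

definition rescaled_integrand :: "nat \<Rightarrow> real \<Rightarrow> complex" where
  "rescaled_integrand i t = indicator {-pi..pi} (width i * t) *\<^sub>R
     (exp (char_exponent k (\<eta> i) (width i * t)) * cis (- (real (n i) * (width i * t)))
      * ((1 - (1 - of_real (width i * x)) * cis (- (width i * t))) / of_real (width i)) ^ d)"

lemma width_pos: "width i > 0"
  using cumulant_2_pos[OF k \<eta>(1,2)] by (simp add: width_def)

lemma width_power2: "cumulant k 2 (\<eta> i) * (width i)\<^sup>2 = 1"
  using cumulant_2_pos[OF k \<eta>(1,2), of i] by (simp add: width_def power_divide)

lemma width_tendsto: "width \<longlonglongrightarrow> 0"
proof -
  have "(\<lambda>i. (width i)\<^sup>2) \<longlonglongrightarrow> 0"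
  proof (rule real_tendsto_sandwich[OF _ _ tendsto_const])
    show "\<forall>\<^sub>F i in sequentially. 0 \<le> (width i)\<^sup>2" by simp
    show "\<forall>\<^sub>F i in sequentially. (width i)\<^sup>2 \<le> 192 * real k ^ 3 * exp 1 * \<eta> i ^ 3"
    proof (rule always_eventually, rule allI)
      fix i
      have "(width i)\<^sup>2 = 1 / cumulant k 2 (\<eta> i)"
        using cumulant_2_pos[OF k \<eta>(1,2), of i] by (simp add: width_def power_divide)
      also have "\<dots> \<le> 1 / (exp (- 1) / (192 * real k ^ 3) / \<eta> i ^ 3)"
        using k \<eta>(1)[of i] cumulant_2_pos[OF k \<eta>(1,2), of i]
        by (intro divide_left_mono cumulant_2_lower[OF k \<eta>(1,2)]) auto
      also have "\<dots> = 192 * real k ^ 3 * exp 1 * \<eta> i ^ 3"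
        by (simp add: exp_minus field_simps)
      finally show "(width i)\<^sup>2 \<le> 192 * real k ^ 3 * exp 1 * \<eta> i ^ 3" .
    qed
    show "(\<lambda>i. 192 * real k ^ 3 * exp 1 * \<eta> i ^ 3) \<longlonglongrightarrow> 0"
      by (auto intro!: tendsto_eq_intros \<eta>(3))
  qed
  from tendsto_real_sqrt[OF this] show ?thesis using width_pos by (simp add: less_imp_le)
qed

lemma skewness_tendsto: "(\<lambda>i. cumulant k 3 (\<eta> i) * width i ^ 3) \<longlonglongrightarrow> 0"
proof -
  have "(\<lambda>i. (cumulant k 3 (\<eta> i) * width i ^ 3)\<^sup>2) \<longlonglongrightarrow> 0"
  proof (rule real_tendsto_sandwich[OF _ _ tendsto_const])
    show "\<forall>\<^sub>F i in sequentially. (cumulant k 3 (\<eta> i) * width i ^ 3)\<^sup>2 \<le> 192\<^sup>2 * (192 * real k ^ 3 * exp 1) ^ 3 * \<eta> i"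
      unfolding width_def by (intro always_eventually allI skewness_le[OF k \<eta>(1,2)])
    show "(\<lambda>i. 192\<^sup>2 * (192 * real k ^ 3 * exp 1) ^ 3 * \<eta> i) \<longlonglongrightarrow> 0"
      by (auto intro!: tendsto_eq_intros \<eta>(3))
  qed simp
  from tendsto_real_sqrt[OF this] have "(\<lambda>i. \<bar>cumulant k 3 (\<eta> i) * width i ^ 3\<bar>) \<longlonglongrightarrow> 0"
    by simp
  then show ?thesis by (simp only: tendsto_rabs_zero_iff)
qed

text \<open>The saddle point equation cancels the linear term, the choice of the width makes the
  quadratic term exactly t^2/2, and the cubic error is the vanishing skewness times |t|^3/6.\<close>

lemma char_fun_tendsto:
  "(\<lambda>i. exp (char_exponent k (\<eta> i) (width i * t)) * cis (- (real (n i) * (width i * t)))) \<longlonglongrightarrow> of_real (exp (- t\<^sup>2 / 2))"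
proof -
  have "(\<lambda>i. char_exponent k (\<eta> i) (width i * t) - \<i> * of_real (real (n i) * (width i * t)) + of_real (t\<^sup>2 / 2)) \<longlonglongrightarrow> 0"
  proof (rule Lim_null_comparison)
    show "\<forall>\<^sub>F i in sequentially. norm (char_exponent k (\<eta> i) (width i * t) - \<i> * of_real (real (n i) * (width i * t)) + of_real (t\<^sup>2 / 2))
        \<le> cumulant k 3 (\<eta> i) * width i ^ 3 * (\<bar>t\<bar> ^ 3 / 6)"
    proof (rule always_eventually, rule allI)
      fix i
      have "cumulant k 2 (\<eta> i) * (width i * t)\<^sup>2 / 2 = (cumulant k 2 (\<eta> i) * (width i)\<^sup>2) * t\<^sup>2 / 2"
        by (simp add: power_mult_distrib)
      also have "\<dots> = t\<^sup>2 / 2" unfolding width_power2 by simp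
      finally have eq: "cumulant k 2 (\<eta> i) * (width i * t)\<^sup>2 / 2 = t\<^sup>2 / 2" .
      show "norm (char_exponent k (\<eta> i) (width i * t) - \<i> * of_real (real (n i) * (width i * t)) + of_real (t\<^sup>2 / 2))
        \<le> cumulant k 3 (\<eta> i) * width i ^ 3 * (\<bar>t\<bar> ^ 3 / 6)"
        using char_exponent_taylor[OF \<eta>(1)[of i], of k "width i * t"] width_pos[of i]
        unfolding eq saddle by (simp add: abs_mult power_mult_distrib)
    qed
    show "(\<lambda>i. cumulant k 3 (\<eta> i) * width i ^ 3 * (\<bar>t\<bar> ^ 3 / 6)) \<longlonglongrightarrow> 0"
      by (rule tendsto_mult_left_zero[OF skewness_tendsto])
  qed
  then have "(\<lambda>i. char_exponent k (\<eta> i) (width i * t) - \<i> * of_real (real (n i) * (width i * t)) + of_real (t\<^sup>2 / 2) - of_real (t\<^sup>2 / 2)) \<longlonglongrightarrow> 0 - of_real (t\<^sup>2 / 2)"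
    by (intro tendsto_diff tendsto_const)
  then have "(\<lambda>i. exp (char_exponent k (\<eta> i) (width i * t) - \<i> * of_real (real (n i) * (width i * t)))) \<longlonglongrightarrow> exp (- of_real (t\<^sup>2 / 2))"
    by (intro tendsto_exp) simp
  moreover have "exp (z - \<i> * of_real a) = exp z * cis (- a)" for z a
    by (simp add: cis_conv_exp flip: exp_add)
  moreover have "exp (- complex_of_real (t\<^sup>2 / 2)) = of_real (exp (- t\<^sup>2 / 2))"
    by (simp add: exp_of_real[symmetric])
  ultimately show ?thesis by (simp only:)
qed

lemma rescaled_integrand_tendsto:
  "(\<lambda>i. rescaled_integrand i t) \<longlonglongrightarrow> of_real (exp (- t\<^sup>2 / 2)) * (of_real x + \<i> * of_real t) ^ d"
proof -
  have "(\<lambda>i. width i * t) \<longlonglongrightarrow> 0 * t" by (intro tendsto_intros width_tendsto)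
  then have "\<forall>\<^sub>F i in sequentially. dist (width i * t) 0 < pi"
    by (intro tendstoD) auto
  then have "\<forall>\<^sub>F i in sequentially. indicat_real {-pi..pi} (width i * t) = 1"
    by eventually_elim (auto simp: dist_real_def indicator_def abs_less_iff)
  then have "(\<lambda>i. indicat_real {-pi..pi} (width i * t)) \<longlonglongrightarrow> 1"
    by (rule tendsto_eventually)
  then have "(\<lambda>i. rescaled_integrand i t) \<longlonglongrightarrow> 1 *\<^sub>R (of_real (exp (- t\<^sup>2 / 2)) * (of_real x + \<i> * of_real t) ^ d)"
    unfolding rescaled_integrand_def
    by (intro tendsto_scaleR tendsto_mult tendsto_power char_fun_tendsto rescaled_factor_tendsto width_pos width_tendsto)
  then show ?thesis by simp
qed

lemma rescaled_integrand_bound: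
  "\<exists>C. \<forall>i t. norm (rescaled_integrand i t) \<le> C * inverse (1 + t\<^sup>2)"
proof -
  define c where "c = exp (- 1) / (6291456 * real k ^ 6)"
  have "c > 0" using k by (simp add: c_def)
  \<comment> \<open>Of the \<open>Suc d\<close> factors 1 + t^2, d offset the growth of the rescaled
    bracket and one is left for the integrable majorant 1/(1 + t^2).\<close>
  then obtain C where C: "\<And>X t. X \<ge> 0 \<Longrightarrow> t\<^sup>2 \<le> 2560 * X ^ 3 \<Longrightarrow> (1 + t\<^sup>2) ^ Suc d * exp (- (c * min X (t\<^sup>2 / 4096))) \<le> C"
    using min_decay_bound[of c "Suc d"] by blast
  have C0: "C \<ge> 0" using order_trans[OF _ C[of 0 0]] by simp
  show ?thesis
  proof (intro exI allI)
    fix i t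
    show "norm (rescaled_integrand i t) \<le> (C * (2 * (1 + \<bar>x\<bar>)) ^ d) * inverse (1 + t\<^sup>2)"
    proof (cases "\<bar>width i * t\<bar> \<le> pi")
      case False
      then have "rescaled_integrand i t = 0" by (auto simp: rescaled_integrand_def indicator_def)
      then show ?thesis using C0 by simp
    next
      case True
      then obtain X where X: "X \<ge> 0" "t\<^sup>2 \<le> 2560 * X ^ 3"
        "norm (exp (char_exponent k (\<eta> i) (width i * t))) \<le> exp (- (c * min X (t\<^sup>2 / 4096)))"
        using char_decay[OF k \<eta>(1,2), of i t] unfolding width_def c_def by blast
      have pos: "1 + t\<^sup>2 > 0" by (simp add: add_pos_nonneg)
      have "(1 + t\<^sup>2) ^ Suc d * norm (exp (char_exponent k (\<eta> i) (width i * t)))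
          \<le> (1 + t\<^sup>2) ^ Suc d * exp (- (c * min X (t\<^sup>2 / 4096)))"
        using X(3) pos by (intro mult_left_mono zero_le_power) auto
      also have "\<dots> \<le> C" by (rule C[OF X(1,2)])
      finally have E: "norm (exp (char_exponent k (\<eta> i) (width i * t))) \<le> C / (1 + t\<^sup>2) ^ Suc d"
        by (subst pos_le_divide_eq) (use pos in \<open>simp_all add: mult.commute\<close>)
      have "norm (rescaled_integrand i t) \<le> norm (exp (char_exponent k (\<eta> i) (width i * t)))
          * norm ((1 - (1 - of_real (width i * x)) * cis (- (width i * t))) / of_real (width i)) ^ d"
        by (simp add: rescaled_integrand_def norm_mult norm_power indicator_def)
      also have "\<dots> \<le> C / (1 + t\<^sup>2) ^ Suc d * (2 * (1 + \<bar>x\<bar>) * (1 + t\<^sup>2)) ^ d"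
        using E C0 rescaled_factor_le[OF width_pos] by (intro mult_mono power_mono) auto
      also have "\<dots> = (C * (2 * (1 + \<bar>x\<bar>)) ^ d) * inverse (1 + t\<^sup>2)"
      proof -
        have "C / P ^ Suc d * (B * P) ^ d = (C * B ^ d) * inverse P" if "P > 0" for P B :: real
          using that by (simp add: power_mult_distrib field_simps)
        then show ?thesis using pos .
      qed
      finally show ?thesis .
    qed
  qed
qed

lemma rescaled_integrand_measurable [measurable]: "rescaled_integrand i \<in> borel_measurable lborel"
proof -
  have [measurable]: "cis \<in> borel_measurable borel"
    by (intro borel_measurable_continuous_onI continuous_intros)
  have [measurable]: "(\<lambda>t. exp (char_exponent k (\<eta> i) (width i * t))) \<in> borel_measurable lborel"
    unfolding char_exponent_def
    by (intro borel_measurable_continuous_on[OF continuous_on_exp[OF continuous_on_id]] borel_measurable_suminf) measurable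
  show ?thesis
    unfolding rescaled_integrand_def[abs_def] by measurable
qed

lemma rescaled_integral_tendsto:
  "(\<lambda>i. \<integral>t. rescaled_integrand i t \<partial>lborel) \<longlonglongrightarrow> of_real (sqrt (2 * pi) * hermite d x)"
proof -
  obtain C where C: "\<And>i t. norm (rescaled_integrand i t) \<le> C * inverse (1 + t\<^sup>2)"
    using rescaled_integrand_bound by blast
  have "(\<lambda>i. \<integral>t. rescaled_integrand i t \<partial>lborel)
      \<longlonglongrightarrow> (\<integral>t. of_real (exp (- t\<^sup>2 / 2)) * (of_real x + \<i> * of_real t) ^ d \<partial>lborel)"
  proof (rule integral_dominated_convergence[where w = "\<lambda>t. C * inverse (1 + t\<^sup>2)"])
    show "(\<lambda>t. complex_of_real (exp (- t\<^sup>2 / 2)) * (of_real x + \<i> * of_real t) ^ d) \<in> borel_measurable lborel"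
      by measurable
    show "integrable lborel (\<lambda>t. C * inverse (1 + t\<^sup>2))"
      by (intro integrable_mult_right integrable_inverse_one_plus_square)
  qed (use rescaled_integrand_tendsto C in auto)
  then show ?thesis by (simp only: gaussian_integral_hermite)
qed

lemma rescaled_integral_eq:
  defines "r \<equiv> \<lambda>i. exp (- \<eta> i)"
  shows "(\<integral>t. rescaled_integrand i t \<partial>lborel) = of_real
    (2 * pi * r i ^ n i / (width i ^ Suc d * exp (cumulant k 0 (\<eta> i)))
      * poly (jensen_poly (\<lambda>m. real (num_regular_partitions k m)) d (n i)) (- r i * (1 - width i * x)))"
proof -
  have r: "0 < r i" "r i < 1" using \<eta>(1)[of i] by (simp_all add: r_def)
  let ?c = "complex_of_real (1 / (width i ^ d * exp (cumulant k 0 (\<eta> i))))"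
  let ?X = "- r i * (1 - width i * x)"
  let ?h = "\<lambda>y. indicator {-pi..pi} y *\<^sub>R (gen_fun k (of_real (r i) * cis y) * cis (- (real (n i) * y)) * (1 + of_real (?X / r i) * cis (- y)) ^ d)"
  have X: "?X / r i = - (1 - width i * x)" using r by simp
  have "rescaled_integrand i t = ?c * ?h (width i * t)" for t
    using width_pos[of i] unfolding rescaled_integrand_def X unfolding r_def gen_fun_eq[OF \<eta>(1)]
    by (simp add: power_divide scaleR_conv_of_real field_simps)
  then have "(\<integral>t. rescaled_integrand i t \<partial>lborel) = (\<integral>t. ?c * ?h (width i * t) \<partial>lborel)"
    by (simp only:)
  also have "\<dots> = ?c * (\<integral>t. ?h (0 + width i * t) \<partial>lborel)"
    by (simp only: integral_mult_right_zero add_0)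
  also have "(\<integral>t. ?h (0 + width i * t) \<partial>lborel) = of_real (1 / width i) * (\<integral>y. ?h y \<partial>lborel)"
    using lborel_integral_real_affine[of "width i" ?h 0] width_pos[of i]
    by (simp add: scaleR_conv_of_real field_simps)
  also have "(\<integral>y. ?h y \<partial>lborel)
      = of_real (2 * pi * r i ^ n i * poly (jensen_poly (\<lambda>m. real (num_regular_partitions k m)) d (n i)) ?X)"
    by (rule jensen_poly_integral[OF r])
  also have "?c * (of_real (1 / width i) * \<dots>) = of_real
    (2 * pi * r i ^ n i / (width i ^ Suc d * exp (cumulant k 0 (\<eta> i)))
      * poly (jensen_poly (\<lambda>m. real (num_regular_partitions k m)) d (n i)) ?X)"
    by (simp add: field_simps)
  finally show ?thesis .
qed

text \<open>The normalising factor is positive, so the sign of the limit passes to the polynomial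
  itself.\<close>

lemma eventually_jensen_sign:
  assumes "s * hermite d x > 0"
  shows "\<forall>\<^sub>F i in sequentially. s * poly (jensen_poly (\<lambda>m. real (num_regular_partitions k m)) d (n i))
    (- exp (- \<eta> i) * (1 - width i * x)) > 0"
proof -
  define a where "a i = 2 * pi * exp (- \<eta> i) ^ n i / (width i ^ Suc d * exp (cumulant k 0 (\<eta> i)))" for i
  define p where "p i = poly (jensen_poly (\<lambda>m. real (num_regular_partitions k m)) d (n i)) (- exp (- \<eta> i) * (1 - width i * x))" for i
  have "(\<lambda>i. complex_of_real (a i * p i)) \<longlonglongrightarrow> of_real (sqrt (2 * pi) * hermite d x)"
    using rescaled_integral_tendsto unfolding rescaled_integral_eq a_def p_def .
  then have "(\<lambda>i. a i * p i) \<longlonglongrightarrow> sqrt (2 * pi) * hermite d x"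
    by (simp only: tendsto_of_real_iff)
  then have "(\<lambda>i. s * (a i * p i)) \<longlonglongrightarrow> s * (sqrt (2 * pi) * hermite d x)"
    by (rule tendsto_mult_left)
  moreover have "s * (sqrt (2 * pi) * hermite d x) > 0"
    using mult_pos_pos[OF assms, of "sqrt (2 * pi)"] by (simp add: mult_ac)
  ultimately have "\<forall>\<^sub>F i in sequentially. s * (a i * p i) > 0"
    by (rule order_tendstoD)
  then show ?thesis
    unfolding p_def[symmetric]
  proof eventually_elim
    case (elim i)
    have "a i > 0" using width_pos[of i] by (simp add: a_def)
    moreover have "0 < a i * (s * p i)" using elim by (simp add: mult_ac)
    ultimately show ?case by (simp only: zero_less_mult_pos)
  qed
qed

end

lemma degree_jensen_poly_le: "degree (jensen_poly \<alpha> d n) \<le> d"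
  unfolding jensen_poly_def
  by (intro degree_sum_le) (auto intro: order_trans[OF degree_monom_le])

theorem corollary1p20:
  fixes k d :: nat
  assumes "k \<ge> 2" and "d \<ge> 1"
  shows "\<forall>\<^sub>F n in sequentially.
           hyperbolic (jensen_poly (\<lambda>m. real (num_regular_partitions k m)) d n)"
proof -
  have k: "k \<ge> 2" by fact
  obtain \<eta> where \<eta>: "\<forall>\<^sub>F n in sequentially. \<eta> n > 0 \<and> cumulant k 1 (\<eta> n) = real n" "\<eta> \<longlonglongrightarrow> 0"
    by (rule saddle_points[OF k])
  have "\<forall>\<^sub>F n in sequentially. \<eta> n < 1 / (128 * real k)"
    using k by (intro order_tendstoD(2)[OF \<eta>(2)]) simp
  with \<eta>(1) have "\<forall>\<^sub>F n in sequentially. \<eta> n > 0 \<and> cumulant k 1 (\<eta> n) = real n \<and> \<eta> n * (128 * real k) \<le> 1"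
    by eventually_elim (use k in \<open>auto simp: field_simps\<close>)
  then obtain N where N: "\<And>n. n \<ge> N \<Longrightarrow> \<eta> n > 0 \<and> cumulant k 1 (\<eta> n) = real n \<and> \<eta> n * (128 * real k) \<le> 1"
    by (auto simp: eventually_at_top_linorder)
  \<comment> \<open>The shift by N makes the eventual properties of \<eta> hold for all indices; it
    is undone at the end.\<close>
  define \<eta>' where "\<eta>' i = \<eta> (i + N)" for i
  have \<eta>': "\<And>i. 0 < \<eta>' i" "\<And>i. \<eta>' i * (128 * real k) \<le> 1" "\<eta>' \<longlonglongrightarrow> 0"
      "\<And>i. cumulant k 1 (\<eta>' i) = real (i + N)"
    using N LIMSEQ_ignore_initial_segment[OF \<eta>(2), of N] unfolding \<eta>'_def by auto
  obtain x where x: "\<And>i. i < d \<Longrightarrow> x i < x (Suc i)" "\<And>i. i \<le> d \<Longrightarrow> (- 1) ^ (d + i) * hermite d (x i) > 0"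
    using hermite_alternates[of d] by blast
  let ?J = "\<lambda>n. jensen_poly (\<lambda>m. real (num_regular_partitions k m)) d n"
  \<comment> \<open>As \<open>exp\<close> and the width are positive, z is increasing in
    \<open>x i\<close>, so the order of the Hermite alternation points is preserved.\<close>
  define z where "z m i = - exp (- \<eta>' m) * (1 - width k \<eta>' m * x i)" for m i
  have "\<forall>\<^sub>F m in sequentially. (- 1) ^ (d + i) * poly (?J (m + N)) (z m i) > 0" if "i \<le> d" for i
    unfolding z_def by (rule eventually_jensen_sign[OF k \<eta>' x(2)[OF that]])
  then have "\<forall>\<^sub>F m in sequentially. \<forall>i\<in>{..d}. (- 1) ^ (d + i) * poly (?J (m + N)) (z m i) > 0"
    by (intro eventually_ball_finite) auto
  then have "\<forall>\<^sub>F m in sequentially. hyperbolic (?J (m + N))"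
  proof eventually_elim
    case (elim m)
    show ?case
    proof (rule hyperbolic_if_alternates[OF degree_jensen_poly_le])
      show "z m i < z m (Suc i)" if "i < d" for i
        using x(1)[OF that] width_pos[OF k \<eta>', of m] by (simp add: z_def)
    qed (use elim in auto)
  qed
  then show ?thesis
    using eventually_sequentially_seg[of "\<lambda>n. hyperbolic (?J n)" N] by simp
qed

end
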